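(* Let $l$ be odd, $R=\mathbb F_2[x]/(x^l+1)$, and $A\in R^{m_A\times n_A}$. Let $G_A,E_A,G_{A^*},E_{A^*}$ be the matrices over $R$ constructed in the context. Then $$\mathrm{rs}_R\,G_A=\ker_R A,\qquad \mathrm{rs}_{\mathbb F_2}E_A\cong\mathrm{coker}_R A,$$ $$\mathrm{rs}_{\mathbb F_2}G_{A^*}=\ker_R A^*,\qquad \mathrm{rs}_R E_{A^*}\cong\mathrm{coker}_R A^*,$$ where $\mathrm{rs}_S$ denotes the span of the rows over $S$ and the two isomorphisms are the restrictions of the quotient maps $R^{m_A}\to R^{m_A}/\mathrm{im}_R A$ and $R^{n_A}\to R^{n_A}/\mathrm{im}_R A^*$. Moreover $G_{A^*}$ and $E_A$ are minimal (over $\mathbb F_2$) generating matrices of $\ker_R A^*$ and $\mathrm{coker}_R A$, respectively, i.e. they have the minimum possible number of rows among matrices whose rows generate over $\mathbb F_2$.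
   Context: Conjugation: for $f\in R$, $\bar f(x)=f(x^{-1})$, $x^{-1}=x^{l-1}$, applied entrywise; $A^*=\bar A^{T}$. $[x^m]f$ denotes the coefficient of $x^m$. Field components: $x^l+1=\prod_{i=1}^t b^{(i)}$ with distinct irreducible $b^{(i)}\in\mathbb F_2[x]$, $d_i=\deg b^{(i)}$, $q_i=2^{d_i}$, $\beta_i$ a root of $b^{(i)}$, and $R_{(i)}=\mathbb F_2[x]/(b^{(i)})\cong\mathbb F_{q_i}$. $c_{b^{(i)}}\in R$ is the idempotent with $c_{b^{(i)}}\equiv1\bmod b^{(i)}$ and $\equiv0\bmod b^{(j)}$ for $j\ne i$. $\mathrm{ev}_{\beta_i}:c_{b^{(i)}}R\to\mathbb F_{q_i}$, $h\mapsto h(\beta_i)$, is a ring isomorphism, applied entrywise to vectors and matrices. $A_{(i)}=\mathrm{ev}_{\beta_i}(c_{b^{(i)}}A)=A(\beta_i)$. An information set of a $k$-dimensional linear code is a set of $k$ coordinates on which restriction is injective; the systematic generator matrix with respect to it is the generator matrix whose restriction to it is the identity. Construction. For each $i=1,\dots,t$: - $I_A^{(i)}\subseteq[n_A]$ is an information set of $\ker A_{(i)}$, with systematic generator matrix having rows $g^{(i,j)}_{\mathcal A_1}$, $j\in I_A^{(i)}$; $e^{(i,j)}_{\mathcal A_1}$ is the unit vector of length $n_A$ at index $j\in I_A^{(i)}$. - $I_{A^*}^{(i)}\subseteq[m_A]$ is an information set of $\ker A_{(i)}^T$, with systematic generator matrix having rows $g^{(i,j)}_{\mathcal A_0}$,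 $j\in I_{A^*}^{(i)}$; $e^{(i,j)}_{\mathcal A_0}$ is the unit vector of length $m_A$ at index $j\in I_{A^*}^{(i)}$. - $m^{(i)}_0,\dots,m^{(i)}_{d_i-1}\in\{0,\dots,l-1\}$ are distinct integers such that $\{\beta_i^{-m_k^{(i)}}\}_{k}$ is an $\mathbb F_2$-basis of $\mathbb F_{q_i}$, and $h^{(i)}_{m^{(i)}_k}\in R$ satisfy $[x^{m_j^{(i)}}](c_{b^{(i)}}h^{(i)}_{m_k^{(i)}})=\delta_{jk}$. Then, stacking over all $i$: $G_A$ has rows $\mathrm{ev}_{\beta_i}^{-1}(g^{(i,j)}_{\mathcal A_1})$, $j\in I_A^{(i)}$; $E_A$ has rows $h^{(i)}_{m^{(i)}_k}c_{b^{(i)}}e^{(i,j)}_{\mathcal A_0}$, $j\in I_{A^*}^{(i)}$, $0\le k<d_i$; $G_{A^*}$ has rows $x^{m^{(i)}_k}\,\overline{\mathrm{ev}_{\beta_i}^{-1}(g^{(i,j)}_{\mathcal A_0})}$, $j\in I_{A^*}^{(i)}$, $0\le k<d_i$; $E_{A^*}$ has rows $\overline{c_{b^{(i)}}}\,e^{(i,j)}_{\mathcal A_1}$, $j\in I_A^{(i)}$. *)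

theory Defs
  imports
    "HOL-Library.Cardinality"
    "HOL-Library.Z2"
    "HOL-Number_Theory.Cong"
    "HOL-Algebra.AbelCoset"
    "Jordan_Normal_Form.Matrix_Kernel"
begin

section \<open>The ring of binary polynomials modulo \<open>x ^ l + 1\<close>\<close>

text \<open>The exponent \<open>l\<close> is the cardinality of the index type \<open>'l\<close>; \<open>\<bbbF>\<^sub>2\<close> is the field \<^typ>\<open>bit\<close>.\<close>

definition cyc_modulus :: "'l::finite itself \<Rightarrow> bit poly" where
  "cyc_modulus _ = monom 1 CARD('l) + 1"

definition cyc_rel :: "'l::finite itself \<Rightarrow> bit poly \<Rightarrow> bit poly \<Rightarrow> bool" where
  "cyc_rel l p q \<longleftrightarrow> [p = q] (mod cyc_modulus l)"

quotient_type 'l cyc = "bit poly" / "cyc_rel TYPE('l::finite)"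
  by (rule equivpI) (auto simp: reflp_def symp_def transp_def cyc_rel_def cong_def)

lemma degree_cyc_modulus: "degree (cyc_modulus TYPE('l::finite)) = CARD('l)"
  unfolding cyc_modulus_def
  by (subst degree_add_eq_left) (simp_all add: degree_monom_eq)

instantiation cyc :: (finite) comm_ring_1
begin

lift_definition zero_cyc :: "'a cyc" is 0 .
lift_definition one_cyc :: "'a cyc" is 1 .
lift_definition plus_cyc :: "'a cyc \<Rightarrow> 'a cyc \<Rightarrow> 'a cyc" is "(+)"
  unfolding cyc_rel_def by (rule cong_add)
lift_definition minus_cyc :: "'a cyc \<Rightarrow> 'a cyc \<Rightarrow> 'a cyc" is "(-)"
  unfolding cyc_rel_def by (rule cong_diff)
lift_definition uminus_cyc :: "'a cyc \<Rightarrow> 'a cyc" is uminus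
  unfolding cyc_rel_def by (simp add: cong_minus_minus_iff)
lift_definition times_cyc :: "'a cyc \<Rightarrow> 'a cyc \<Rightarrow> 'a cyc" is "(*)"
  unfolding cyc_rel_def by (rule cong_mult)

instance
proof
  have "\<not> [0 = 1] (mod cyc_modulus TYPE('a))"
  proof
    assume "[0 = 1] (mod cyc_modulus TYPE('a))"
    then have "is_unit (cyc_modulus TYPE('a))"
      by (metis cong_0_iff cong_sym_eq)
    then have "degree (cyc_modulus TYPE('a)) = 0"
      by (auto simp: is_unit_poly_iff)
    then show False
      by (simp add: degree_cyc_modulus)
  qed
  then show "(0::'a cyc) \<noteq> 1"
    by transfer (simp add: cyc_rel_def)
qed (transfer; simp add: cyc_rel_def algebra_simps)+

end

definition cyc_of_poly :: "bit poly \<Rightarrow> 'l::finite cyc" where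
  "cyc_of_poly = abs_cyc"

text \<open>The representative of degree less than \<open>l\<close>; in particular \<open>[x\<^sup>m]f\<close> is
  \<open>coeff (cyc_rep f) m\<close>.\<close>

definition cyc_rep :: "'l::finite cyc \<Rightarrow> bit poly" where
  "cyc_rep f = rep_cyc f mod cyc_modulus TYPE('l)"

lemma cyc_rep_of_poly: "cyc_rep (cyc_of_poly p :: 'l::finite cyc) = p mod cyc_modulus TYPE('l)"
proof -
  have "cyc_rel TYPE('l) (rep_cyc (abs_cyc p :: 'l cyc)) p"
    by (rule Quotient3_rep_abs[OF Quotient3_cyc]) (simp add: cyc_rel_def)
  then show ?thesis
    by (simp add: cyc_rep_def cyc_of_poly_def cyc_rel_def cong_def)
qed

definition cyc_x :: "'l::finite cyc" where
  "cyc_x = cyc_of_poly (monom 1 1)"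

lemma cong_pcompose:
  fixes p q :: "bit poly"
  assumes pq: "[p = q] (mod m)" and m: "m dvd pcompose m r"
  shows "[pcompose p r = pcompose q r] (mod m)"
proof -
  have "m dvd p - q"
    using pq by (simp add: cong_iff_dvd_diff)
  then obtain s where "p - q = m * s" ..
  then have "pcompose p r - pcompose q r = pcompose m r * pcompose s r"
    by (metis pcompose_diff pcompose_mult)
  then show ?thesis
    using m by (simp add: cong_iff_dvd_diff)
qed

lemma cyc_modulus_dvd_pcompose:
  "cyc_modulus TYPE('l) dvd pcompose (cyc_modulus TYPE('l::finite)) (monom 1 (CARD('l) - 1))"
proof -
  let ?y = "monom (1::bit) CARD('l)"
  have uminus: "- p = p" for p :: "bit poly"
    by (rule poly_eqI) simp
  have "pcompose (monom 1 n) r = r ^ n" for n and r :: "bit poly"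
    by (induction n) (simp_all add: monom_Suc pcompose_pCons pcompose_1)
  then have "pcompose (cyc_modulus TYPE('l)) (monom 1 (CARD('l) - 1)) = ?y ^ (CARD('l) - 1) + 1"
    by (simp add: cyc_modulus_def pcompose_add monom_power mult.commute pcompose_1)
  moreover have "?y - 1 dvd ?y ^ (CARD('l) - 1) - 1"
    by (metis dvd_triv_left power_diff_1_eq)
  ultimately show ?thesis
    by (simp add: cyc_modulus_def diff_conv_add_uminus uminus del: add_uminus_conv_diff)
qed

text \<open>The conjugation \<open>f(x) \<mapsto> f(x\<^sup>l\<^sup>-\<^sup>1)\<close>.\<close>

lift_definition cyc_conj :: "'l::finite cyc \<Rightarrow> 'l cyc"
  is "\<lambda>p. pcompose p (monom 1 (CARD('l) - 1))"
  unfolding cyc_rel_def by (rule cong_pcompose[OF _ cyc_modulus_dvd_pcompose])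

definition adjoint_mat :: "'l::finite cyc mat \<Rightarrow> 'l cyc mat" where
  "adjoint_mat A = transpose_mat (map_mat cyc_conj A)"

section \<open>Evaluation at a root\<close>

text \<open>All fields \<open>\<bbbF>\<^bsub>q\<^sub>i\<^esub> = \<bbbF>\<^sub>2(\<beta>\<^sub>i)\<close> are realised as subfields of one field \<open>'k\<close> of characteristic 2.\<close>

definition eval_poly2 :: "'k::field \<Rightarrow> bit poly \<Rightarrow> 'k" where
  "eval_poly2 \<beta> p = poly (map_poly of_bit p) \<beta>"

definition Fq :: "'k::field \<Rightarrow> 'k set" where
  "Fq \<beta> = range (eval_poly2 \<beta>)"

definition ev :: "'k::field \<Rightarrow> 'l::finite cyc \<Rightarrow> 'k" where
  "ev \<beta> f = eval_poly2 \<beta> (cyc_rep f)"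

text \<open>The inverse of \<open>ev\<^sub>\<beta> : c R \<rightarrow> \<bbbF>\<^sub>2(\<beta>)\<close>.\<close>

definition ev_inv :: "'l::finite cyc \<Rightarrow> 'k::field \<Rightarrow> 'k \<Rightarrow> 'l cyc" where
  "ev_inv c \<beta> = the_inv_into (range ((*) c)) (ev \<beta>)"

definition component_mat :: "'l::finite cyc \<Rightarrow> 'k::field \<Rightarrow> 'l cyc mat \<Rightarrow> 'k mat" where
  "component_mat c \<beta> A = map_mat (ev \<beta>) (c \<cdot>\<^sub>m A)"

definition F2_basis_family :: "'k::field set \<Rightarrow> nat set \<Rightarrow> (nat \<Rightarrow> 'k) \<Rightarrow> bool" where
  "F2_basis_family F K f \<longleftrightarrow> inj_on f K
     \<and> \<not> Modules.module.dependent (\<lambda>(b::bit) y. of_bit b * y) (f ` K)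
     \<and> Modules.module.span (\<lambda>(b::bit) y. of_bit b * y) (f ` K) = F"

section \<open>Row spans and cokernels\<close>

text \<open>A subset \<open>S\<close> of a ring type, meant to be closed under the operations, as a ring of scalars.\<close>

definition scalars :: "'a::comm_ring_1 set \<Rightarrow> 'a ring" where
  "scalars S = class_ring\<lparr>carrier := S\<rparr>"

definition row_span :: "'a::comm_ring_1 set \<Rightarrow> 'a mat \<Rightarrow> 'a vec set" where
  "row_span S M =
     LinearCombinations.module.span (scalars S) (module_vec TYPE('a) (dim_col M)) (set (rows M))"

text \<open>The copy of \<open>\<bbbF>\<^sub>2\<close> in \<open>R\<close>.\<close>

definition F2 :: "'l::finite cyc set" where
  "F2 = {0, 1}"

definition mat_image :: "'a::comm_ring_1 mat \<Rightarrow> 'a vec set" where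
  "mat_image A = (\<lambda>v. A *\<^sub>v v) ` carrier_vec (dim_col A)"

definition coker_map :: "'a::comm_ring_1 mat \<Rightarrow> 'a vec \<Rightarrow> 'a vec set" where
  "coker_map A v = mat_image A +>\<^bsub>module_vec TYPE('a) (dim_row A)\<^esub> v"

text \<open>The ring fields \<open>mult\<close> and \<open>one\<close> of a module record carry no meaning.\<close>

definition coker :: "'a::comm_ring_1 mat \<Rightarrow> ('a, 'a vec set) module" where
  "coker A = (let V = module_vec TYPE('a) (dim_row A) in
     \<lparr>carrier = a_rcosets\<^bsub>V\<^esub> (mat_image A), mult = undefined, one = undefined,
      zero = mat_image A, add = (<+>\<^bsub>V\<^esub>),
      smult = (\<lambda>c X. mat_image A <+>\<^bsub>V\<^esub> (\<lambda>v. c \<cdot>\<^sub>v v) ` X)\<rparr>)"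

text \<open>The quotient map restricts to an \<open>S\<close>-linear isomorphism from the \<open>S\<close>-row span of \<open>E\<close>
  onto the cokernel of \<open>A\<close>.\<close>

definition row_span_iso_coker :: "'a::comm_ring_1 set \<Rightarrow> 'a mat \<Rightarrow> 'a mat \<Rightarrow> bool" where
  "row_span_iso_coker S E A \<longleftrightarrow>
     mod_hom (scalars S) ((module_vec TYPE('a) (dim_row A))\<lparr>carrier := row_span S E\<rparr>)
       (coker A) (coker_map A)
     \<and> bij_betw (coker_map A) (row_span S E) (carrier (coker A))"

definition generates_ker :: "'a::comm_ring_1 set \<Rightarrow> 'a mat \<Rightarrow> 'a mat \<Rightarrow> bool" where
  "generates_ker S G B \<longleftrightarrow> dim_col G = dim_col B \<and> row_span S G = mat_kernel B"

definition generates_coker :: "'a::comm_ring_1 set \<Rightarrow> 'a mat \<Rightarrow> 'a mat \<Rightarrow> bool" where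
  "generates_coker S E B \<longleftrightarrow>
     dim_col E = dim_row B \<and> coker_map B ` row_span S E = carrier (coker B)"

definition fewest_rows :: "('a mat \<Rightarrow> bool) \<Rightarrow> 'a mat \<Rightarrow> bool" where
  "fewest_rows P G \<longleftrightarrow> P G \<and> (\<forall>M. P M \<longrightarrow> dim_row G \<le> dim_row M)"

section \<open>Linear codes\<close>

definition ker_over :: "'k::field set \<Rightarrow> 'k mat \<Rightarrow> 'k vec set" where
  "ker_over F B = {v \<in> mat_kernel B. set\<^sub>v v \<subseteq> F}"

definition code_dim :: "'k::field set \<Rightarrow> nat \<Rightarrow> 'k vec set \<Rightarrow> nat" where
  "code_dim F n C = vectorspace.dim (scalars F) ((module_vec TYPE('k) n)\<lparr>carrier := C\<rparr>)"

text \<open>Coordinates are numbered from 0, as in all vectors and matrices here.\<close>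

definition information_set :: "'k::field set \<Rightarrow> nat \<Rightarrow> 'k vec set \<Rightarrow> nat set \<Rightarrow> bool" where
  "information_set F n C I \<longleftrightarrow>
     I \<subseteq> {0..<n} \<and> card I = code_dim F n C \<and> inj_on (\<lambda>v. restrict (\<lambda>j. v $ j) I) C"

text \<open>The rows \<open>g j\<close> are indexed by the elements \<open>j\<close> of the information set.\<close>

definition systematic_generator ::
  "'k::field set \<Rightarrow> nat \<Rightarrow> 'k vec set \<Rightarrow> nat set \<Rightarrow> (nat \<Rightarrow> 'k vec) \<Rightarrow> bool" where
  "systematic_generator F n C I g \<longleftrightarrow>
     (\<forall>j\<in>I. g j \<in> carrier_vec n)
     \<and> row_span F (mat_of_rows n (map g (sorted_list_of_set I))) = C
     \<and> (\<forall>j\<in>I. \<forall>j'\<in>I. g j $ j' = (if j = j' then 1 else 0))"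

section \<open>The constructed matrices\<close>

text \<open>The components are numbered from 1 to \<open>t\<close>, and \<open>n\<close> is the number of columns.\<close>

definition mat_GA ::
  "nat \<Rightarrow> nat \<Rightarrow> (nat \<Rightarrow> 'l::finite cyc) \<Rightarrow> (nat \<Rightarrow> 'k::field) \<Rightarrow> (nat \<Rightarrow> nat set) \<Rightarrow>
   (nat \<Rightarrow> nat \<Rightarrow> 'k vec) \<Rightarrow> 'l cyc mat" where
  "mat_GA n t c \<beta> I g = mat_of_rows n
     [map_vec (ev_inv (c i) (\<beta> i)) (g i j). i \<leftarrow> [1..<t+1], j \<leftarrow> sorted_list_of_set (I i)]"

definition mat_EA ::
  "nat \<Rightarrow> nat \<Rightarrow> (nat \<Rightarrow> 'l::finite cyc) \<Rightarrow> (nat \<Rightarrow> nat) \<Rightarrow> (nat \<Rightarrow> nat set) \<Rightarrow>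
   (nat \<Rightarrow> nat \<Rightarrow> nat) \<Rightarrow> (nat \<Rightarrow> nat \<Rightarrow> 'l cyc) \<Rightarrow> 'l cyc mat" where
  "mat_EA n t c d I m h = mat_of_rows n
     [(h i (m i k) * c i) \<cdot>\<^sub>v unit_vec n j.
        i \<leftarrow> [1..<t+1], j \<leftarrow> sorted_list_of_set (I i), k \<leftarrow> [0..<d i]]"

definition mat_GA_adj ::
  "nat \<Rightarrow> nat \<Rightarrow> (nat \<Rightarrow> 'l::finite cyc) \<Rightarrow> (nat \<Rightarrow> 'k::field) \<Rightarrow> (nat \<Rightarrow> nat) \<Rightarrow>
   (nat \<Rightarrow> nat set) \<Rightarrow> (nat \<Rightarrow> nat \<Rightarrow> 'k vec) \<Rightarrow> (nat \<Rightarrow> nat \<Rightarrow> nat) \<Rightarrow> 'l cyc mat" where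
  "mat_GA_adj n t c \<beta> d I g m = mat_of_rows n
     [cyc_x ^ m i k \<cdot>\<^sub>v map_vec cyc_conj (map_vec (ev_inv (c i) (\<beta> i)) (g i j)).
        i \<leftarrow> [1..<t+1], j \<leftarrow> sorted_list_of_set (I i), k \<leftarrow> [0..<d i]]"

definition mat_EA_adj ::
  "nat \<Rightarrow> nat \<Rightarrow> (nat \<Rightarrow> 'l::finite cyc) \<Rightarrow> (nat \<Rightarrow> nat set) \<Rightarrow> 'l cyc mat" where
  "mat_EA_adj n t c I = mat_of_rows n
     [cyc_conj (c i) \<cdot>\<^sub>v unit_vec n j. i \<leftarrow> [1..<t+1], j \<leftarrow> sorted_list_of_set (I i)]"

end

theory Submission
  imports Defs
begin

text \<open>
  By the Chinese remainder theorem, evaluation at the roots \<open>\<beta>\<^sub>i\<close> turns a matrix over \<open>R\<close> into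
  a family of matrices \<open>A\<^sub>i\<close> over finite fields. A vector lies in the kernel of \<open>A\<close> iff each of its
  components is the combination of the systematic generators prescribed by its coordinates
  in the information set. By duality, a vector lies in the image of \<open>A\<close> iff its components are
  orthogonal to the generators of the kernels of the transposed components; hence
  the vectors whose components are supported on the information sets form a complement of
  the image. Over \<open>\<bbbF>\<^sub>2\<close>, each coordinate is expanded in a basis of \<open>\<bbbF>\<^bsub>q\<^sub>i\<^esub>\<close>, and the resulting
  rows are independent: with \<open>N\<close> of them the kernel or cokernel has \<open>2\<^sup>N\<close> elements, whereas \<open>r\<close>
  rows generate at most \<open>2\<^sup>r\<close>.
\<close>

section \<open>Row spans as sets of linear combinations\<close>

text \<open>The fields of the components are subsets \<open>Fq (\<beta> i)\<close> of one field
  type, and \<open>F2\<close> is a subset of \<open>R\<close>, so no type carries the scalars.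
  Linear algebra is therefore done with families of coefficients drawn from a set \<open>S\<close>,
  and the duality of kernel and image rests on an explicit alternative for vectors over such a
  subset. Conjugation turns evaluation at \<beta> into evaluation at its inverse, so the adjoint at
  one root involves \<open>A\<close> at another one. To avoid matching roots with their inverses,
  conjugation is applied to whole vectors over \<open>R\<close>, where it is an involution
  exchanging the adjoint with the transpose. Everything then reduces to \<open>A\<close> and its
  transpose, evaluated at the given roots. This also explains the negative powers of \<beta> in the
  basis hypothesis: after conjugation the factor \<open>cyc_x ^ m\<close> takes the value \<beta> to
  the power -m. For the multipliers \<open>h\<close>, independence is instead read off from
  coefficients in \<open>R\<close>.\<close>

definition closed_scalars :: "'a::comm_ring_1 set \<Rightarrow> bool" where
  "closed_scalars S \<longleftrightarrow> 0 \<in> S \<and> 1 \<in> S \<and>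
     (\<forall>x\<in>S. \<forall>y\<in>S. x + y \<in> S \<and> x * y \<in> S) \<and> (\<forall>x\<in>S. - x \<in> S)"

lemma cring_scalars:
  assumes "closed_scalars S"
  shows "cring (scalars S)"
  using assms unfolding closed_scalars_def scalars_def
  by (intro cringI abelian_groupI comm_monoidI)
    (auto simp: algebra_simps intro: bexI[of _ "- _"])

lemma module_scalars:
  fixes S :: "'a::comm_ring_1 set"
  assumes "closed_scalars S"
  shows "Module.module (scalars S) (module_vec TYPE('a) n)"
proof (rule module_criteria[OF cring_scalars[OF assms]])
  show "\<forall>v\<in>carrier (module_vec TYPE('a) n). \<exists>w\<in>carrier (module_vec TYPE('a) n).
      v \<oplus>\<^bsub>module_vec TYPE('a) n\<^esub> w = \<zero>\<^bsub>module_vec TYPE('a) n\<^esub>"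
    by (auto simp: module_vec_simps intro!: bexI[of _ "- _"] intro: uminus_r_inv_vec)
qed (auto simp: module_vec_simps scalars_def smult_smult_assoc add_smult_distrib_vec
    smult_add_distrib_vec comm_add_vec assoc_add_vec[of _ n])

text \<open>The rows form a family over an arbitrary index set, so triples (component, coordinate,
  digit) can serve as indices without a numbering. Taking extensional coefficient functions makes
  the parameter set have exactly \<open>card S ^ card P\<close> elements when \<open>P\<close> is
  finite.\<close>

definition lin_combs ::
  "'a::comm_ring_1 set \<Rightarrow> nat \<Rightarrow> 'p set \<Rightarrow> ('p \<Rightarrow> nat \<Rightarrow> 'a) \<Rightarrow> 'a vec set" where
  "lin_combs S n P f = (\<lambda>a. vec n (\<lambda>k. \<Sum>p\<in>P. a p * f p k)) ` (P \<rightarrow>\<^sub>E S)"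

lemma lin_combsI:
  assumes "v \<in> carrier_vec n" "\<And>p. p \<in> P \<Longrightarrow> a p \<in> S"
    and "\<And>k. k < n \<Longrightarrow> v $ k = (\<Sum>p\<in>P. a p * f p k)"
  shows "v \<in> lin_combs S n P f"
  unfolding lin_combs_def
proof (rule image_eqI)
  show "v = vec n (\<lambda>k. \<Sum>p\<in>P. restrict a P p * f p k)"
    using assms by (intro eq_vecI) auto
qed (use assms in auto)

lemma lin_combs_iff:
  "v \<in> lin_combs S n P f \<longleftrightarrow> v \<in> carrier_vec n \<and>
     (\<exists>a. (\<forall>p\<in>P. a p \<in> S) \<and> (\<forall>k<n. v $ k = (\<Sum>p\<in>P. a p * f p k)))"
proof
  assume "v \<in> lin_combs S n P f"
  then obtain a where "a \<in> P \<rightarrow>\<^sub>E S" "v = vec n (\<lambda>k. \<Sum>p\<in>P. a p * f p k)"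
    by (auto simp: lin_combs_def)
  then show "v \<in> carrier_vec n \<and>
      (\<exists>a. (\<forall>p\<in>P. a p \<in> S) \<and> (\<forall>k<n. v $ k = (\<Sum>p\<in>P. a p * f p k)))"
    by (auto simp: PiE_iff intro!: exI[of _ a])
qed (auto intro: lin_combsI)

lemma submodule_lin_combs:
  fixes S :: "'a::comm_ring_1 set"
  assumes S: "closed_scalars S"
  shows "LinearCombinations.submodule (scalars S) (lin_combs S n P f) (module_vec TYPE('a) n)"
proof (rule LinearCombinations.submodule.intro)
  show "Module.module (scalars S) (module_vec TYPE('a) n)"
    using S by (rule module_scalars)
  show "lin_combs S n P f \<subseteq> carrier (module_vec TYPE('a) n)"
    by (auto simp: lin_combs_def module_vec_simps)
  show "\<zero>\<^bsub>module_vec TYPE('a) n\<^esub> \<in> lin_combs S n P f"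
    using S by (intro lin_combsI[where a = "\<lambda>_. 0"]) (auto simp: module_vec_simps closed_scalars_def)
  fix v w
  assume v_in: "v \<in> lin_combs S n P f" and w_in: "w \<in> lin_combs S n P f"
  from v_in obtain a where v: "v \<in> carrier_vec n" "\<forall>p\<in>P. a p \<in> S"
      "\<forall>k<n. v $ k = (\<Sum>p\<in>P. a p * f p k)"
    by (auto simp: lin_combs_iff)
  from w_in obtain b where w: "w \<in> carrier_vec n" "\<forall>p\<in>P. b p \<in> S"
      "\<forall>k<n. w $ k = (\<Sum>p\<in>P. b p * f p k)"
    by (auto simp: lin_combs_iff)
  show "v \<oplus>\<^bsub>module_vec TYPE('a) n\<^esub> w \<in> lin_combs S n P f"
    using S v w by (intro lin_combsI[where a = "\<lambda>p. a p + b p"])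
      (auto simp: module_vec_simps closed_scalars_def sum.distrib algebra_simps)
next
  fix c v
  assume c: "c \<in> carrier (scalars S)" and "v \<in> lin_combs S n P f"
  then obtain a where v: "v \<in> carrier_vec n" "\<forall>p\<in>P. a p \<in> S"
      "\<forall>k<n. v $ k = (\<Sum>p\<in>P. a p * f p k)"
    by (auto simp: lin_combs_iff)
  show "c \<odot>\<^bsub>module_vec TYPE('a) n\<^esub> v \<in> lin_combs S n P f"
    using S v c by (intro lin_combsI[where a = "\<lambda>p. c * a p"])
      (auto simp: module_vec_simps closed_scalars_def scalars_def sum_distrib_left mult.assoc)
qed

text \<open>Equal rows merge in the set of rows but keep separate coefficients in the family. Hence
  the two sides are compared by inclusions and not by matching coefficients.\<close>

lemma row_span_eq:
  fixes S :: "'a::comm_ring_1 set"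
  assumes S: "closed_scalars S" and M: "dim_col M = n" and P: "finite P"
    and rows: "set (rows M) = (\<lambda>p. vec n (f p)) ` P"
  shows "row_span S M = lin_combs S n P f"
proof -
  let ?V = "module_vec TYPE('a) n"
  interpret Module.module "scalars S" ?V
    using S by (rule module_scalars)
  have sub: "set (rows M) \<subseteq> carrier ?V"
    by (auto simp: rows module_vec_simps)
  have "span (set (rows M)) \<subseteq> lin_combs S n P f"
  proof (rule span_is_subset[OF _ submodule_lin_combs[OF S]], safe)
    fix v assume "v \<in> set (rows M)"
    then obtain p where p: "p \<in> P" "v = vec n (f p)"
      by (auto simp: rows)
    then show "v \<in> lin_combs S n P f"
      using S P by (intro lin_combsI[where a = "\<lambda>q. if q = p then 1 else 0"])
        (auto simp: closed_scalars_def if_distrib[of "\<lambda>x. x * _"] cong: if_cong)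
  qed
  moreover have "lin_combs S n P f \<subseteq> span (set (rows M))"
  proof
    fix v assume "v \<in> lin_combs S n P f"
    then obtain a where a: "\<And>p. p \<in> P \<Longrightarrow> a p \<in> S"
      and v: "v = vec n (\<lambda>k. \<Sum>p\<in>P. a p * f p k)"
      by (auto simp: lin_combs_def PiE_iff)
    interpret LinearCombinations.submodule "scalars S" "span (set (rows M))" ?V
      using sub by (rule span_is_submodule)
    \<comment> \<open>Partial sums are added up inside the span, which as a submodule is closed
      under each further summand.\<close>
    have "vec n (\<lambda>k. \<Sum>p\<in>Q. a p * f p k) \<in> span (set (rows M))" if "Q \<subseteq> P" for Q
      using finite_subset[OF that P] that
    proof (induction Q rule: finite_induct)
      case empty
      then show ?case
        using zero_closed by (simp add: module_vec_simps zero_vec_def)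
    next
      case (insert q Q)
      have "vec n (f q) \<in> span (set (rows M))"
        using in_own_span[OF sub] insert.prems by (auto simp: rows)
      then have "a q \<cdot>\<^sub>v vec n (f q) \<in> span (set (rows M))"
        using smult_closed[of "a q" "vec n (f q)"] a insert.prems
        by (auto simp: module_vec_simps scalars_def)
      moreover have "vec n (\<lambda>k. \<Sum>p\<in>insert q Q. a p * f p k)
          = a q \<cdot>\<^sub>v vec n (f q) + vec n (\<lambda>k. \<Sum>p\<in>Q. a p * f p k)"
        using insert.hyps by (intro eq_vecI) auto
      ultimately show ?case
        using m_closed insert by (auto simp: module_vec_simps)
    qed
    then show "v \<in> span (set (rows M))"
      using v by blast
  qed
  ultimately show ?thesis
    unfolding row_span_def M by blast
qed

lemma row_span_eq_rows:
  assumes "closed_scalars S" "dim_col M = n"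
  shows "row_span S M = lin_combs S n {..<dim_row M} (\<lambda>i k. M $$ (i, k))"
proof (rule row_span_eq[OF assms])
  show "set (rows M) = (\<lambda>i. vec n (\<lambda>k. M $$ (i, k))) ` {..<dim_row M}"
    using assms(2) by (auto simp: rows_def row_def)
qed simp

lemma row_span_mat_of_rows:
  assumes "closed_scalars S" "finite P" "set vs = (\<lambda>p. vec n (f p)) ` P"
  shows "row_span S (mat_of_rows n vs) = lin_combs S n P f"
proof (rule row_span_eq[OF assms(1) _ assms(2)])
  have "set vs \<subseteq> carrier_vec n"
    by (auto simp: assms(3))
  then show "set (rows (mat_of_rows n vs)) = (\<lambda>p. vec n (f p)) ` P"
    by (simp add: assms(3))
qed simp

lemma finite_lin_combs:
  assumes "finite S" "finite P"
  shows "finite (lin_combs S n P f)" and "card (lin_combs S n P f) \<le> card S ^ card P"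
proof -
  have "finite (P \<rightarrow>\<^sub>E S)"
    using assms by (intro finite_PiE) auto
  then show "finite (lin_combs S n P f)" "card (lin_combs S n P f) \<le> card S ^ card P"
    using assms card_image_le[of "P \<rightarrow>\<^sub>E S" "\<lambda>a. vec n (\<lambda>k. \<Sum>p\<in>P. a p * f p k)"]
    by (auto simp: lin_combs_def card_PiE)
qed

text \<open>Independence is phrased as uniqueness of coefficients, so that \<open>S\<close> needs no
  subtraction and injectivity of the coefficient map is immediate.\<close>

lemma card_lin_combs:
  assumes "finite P"
    and "\<And>a b. a \<in> P \<rightarrow> S \<Longrightarrow> b \<in> P \<rightarrow> S \<Longrightarrow>
       (\<And>k. k < n \<Longrightarrow> (\<Sum>p\<in>P. a p * f p k) = (\<Sum>p\<in>P. b p * f p k)) \<Longrightarrow> \<forall>p\<in>P. a p = b p"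
  shows "card (lin_combs S n P f) = card S ^ card P"
proof -
  have "inj_on (\<lambda>a. vec n (\<lambda>k. \<Sum>p\<in>P. a p * f p k)) (P \<rightarrow>\<^sub>E S)"
  proof (rule inj_onI)
    fix a b
    assume ab: "a \<in> P \<rightarrow>\<^sub>E S" "b \<in> P \<rightarrow>\<^sub>E S"
      and eq: "vec n (\<lambda>k. \<Sum>p\<in>P. a p * f p k) = vec n (\<lambda>k. \<Sum>p\<in>P. b p * f p k)"
    have "(\<Sum>p\<in>P. a p * f p k) = (\<Sum>p\<in>P. b p * f p k)" if "k < n" for k
      using arg_cong[OF eq, of "\<lambda>v. v $ k"] that by simp
    then have "\<forall>p\<in>P. a p = b p"
      using ab by (intro assms(2)) (auto simp: PiE_iff)
    then show "a = b"
      using ab by (auto intro: PiE_ext)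
  qed
  then show ?thesis
    using assms(1) by (simp add: lin_combs_def card_image card_PiE)
qed

section \<open>Cokernels\<close>

lemma mat_image_iff: "v \<in> mat_image A \<longleftrightarrow> (\<exists>x\<in>carrier_vec (dim_col A). v = A *\<^sub>v x)"
  by (auto simp: mat_image_def)

lemma mat_image_carrier: "v \<in> mat_image A \<Longrightarrow> v \<in> carrier_vec (dim_row A)"
  by (auto simp: mat_image_iff intro: carrier_vecI)

lemma mat_image_add:
  assumes "v \<in> mat_image A" "w \<in> mat_image A"
  shows "v + w \<in> mat_image A"
proof -
  obtain x y where "x \<in> carrier_vec (dim_col A)" "v = A *\<^sub>v x"
    "y \<in> carrier_vec (dim_col A)" "w = A *\<^sub>v y"
    using assms unfolding mat_image_iff by blast
  then show ?thesis
    unfolding mat_image_iff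
    by (intro bexI[of _ "x + y"]) (simp_all add: mult_add_distrib_mat_vec[of A "dim_row A" "dim_col A"])
qed

lemma mat_image_smult:
  assumes "v \<in> mat_image A"
  shows "c \<cdot>\<^sub>v v \<in> mat_image A"
proof -
  obtain x where x: "x \<in> carrier_vec (dim_col A)" "v = A *\<^sub>v x"
    using assms unfolding mat_image_iff by blast
  have "c \<cdot>\<^sub>v v = A *\<^sub>v (c \<cdot>\<^sub>v x)"
    unfolding x(2) using carrier_vecD[OF x(1)] by (intro eq_vecI) simp_all
  then show ?thesis
    unfolding mat_image_iff using x(1) by (intro bexI[of _ "c \<cdot>\<^sub>v x"]) simp_all
qed

lemma mat_image_zero: "0\<^sub>v (dim_row A) \<in> mat_image A"
proof -
  have "A *\<^sub>v 0\<^sub>v (dim_col A) = 0\<^sub>v (dim_row A)"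
    by (intro eq_vecI) auto
  then show ?thesis
    unfolding mat_image_iff by (intro bexI[of _ "0\<^sub>v (dim_col A)"]) simp_all
qed

lemma mat_image_uminus:
  assumes "v \<in> mat_image A"
  shows "- v \<in> mat_image A"
proof -
  have "- v = (-1) \<cdot>\<^sub>v v"
    by (intro eq_vecI) auto
  then show ?thesis
    using mat_image_smult[OF assms, of "-1"] by simp
qed

lemma abelian_subgroup_mat_image:
  fixes A :: "'a::comm_ring_1 mat"
  shows "abelian_subgroup (mat_image A) (module_vec TYPE('a) (dim_row A))"
proof (rule abelian_subgroupI3)
  have *: "Module.module (scalars UNIV) (module_vec TYPE('a) (dim_row A))"
    by (rule module_scalars) (simp add: closed_scalars_def)
  then show "abelian_group (module_vec TYPE('a) (dim_row A))"
    by (simp add: Module.module_def)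
  then interpret abelian_group "module_vec TYPE('a) (dim_row A)" .
  show "additive_subgroup (mat_image A) (module_vec TYPE('a) (dim_row A))"
  proof (intro additive_subgroup.intro add.subgroupI)
    fix v assume v: "v \<in> mat_image A"
    then have "\<ominus>\<^bsub>module_vec TYPE('a) (dim_row A)\<^esub> v = - v"
      by (intro minus_equality) (auto simp: module_vec_simps dest: mat_image_carrier)
    then show "\<ominus>\<^bsub>module_vec TYPE('a) (dim_row A)\<^esub> v \<in> mat_image A"
      using v by (simp add: mat_image_uminus)
  qed (auto simp: module_vec_simps mat_image_carrier mat_image_add intro: mat_image_zero)
qed

lemma coker_map_eq: "coker_map A v = (\<lambda>u. u + v) ` mat_image A"
  unfolding coker_map_def a_r_coset_def r_coset_def by (auto simp: module_vec_simps)

lemma coker_map_eq_iff: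
  fixes A :: "'a::comm_ring_1 mat"
  assumes v: "v \<in> carrier_vec (dim_row A)" and w: "w \<in> carrier_vec (dim_row A)"
  shows "coker_map A v = coker_map A w \<longleftrightarrow> v - w \<in> mat_image A"
proof
  assume "coker_map A v = coker_map A w"
  moreover have "0\<^sub>v (dim_row A) + v \<in> coker_map A v"
    unfolding coker_map_eq using mat_image_zero by blast
  ultimately obtain u where u: "u \<in> mat_image A" "0\<^sub>v (dim_row A) + v = u + w"
    by (auto simp: coker_map_eq)
  then have "v = u + w"
    using v by simp
  then have "v - w = u"
    using w mat_image_carrier[OF u(1)] by (intro eq_vecI) auto
  then show "v - w \<in> mat_image A"
    using u by simp
next
  assume d: "v - w \<in> mat_image A"
  have sub: "coker_map A x \<subseteq> coker_map A y"
    if "x \<in> carrier_vec (dim_row A)" "y \<in> carrier_vec (dim_row A)" "x - y \<in> mat_image A" for x y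
  proof
    fix z assume "z \<in> coker_map A x"
    then obtain u where u: "u \<in> mat_image A" "z = u + x"
      by (auto simp: coker_map_eq)
    have "z = (u + (x - y)) + y"
      using that(1,2) mat_image_carrier[OF u(1)] u(2) by (intro eq_vecI) auto
    then show "z \<in> coker_map A y"
      using mat_image_add[OF u(1) that(3)] by (auto simp: coker_map_eq)
  qed
  have "w - v = - (v - w)"
    using v w by (intro eq_vecI) auto
  then have "w - v \<in> mat_image A"
    using mat_image_uminus[OF d] by simp
  then show "coker_map A v = coker_map A w"
    using sub[OF v w d] sub[OF w v] by blast
qed

lemma carrier_coker: "carrier (coker A) = coker_map A ` carrier_vec (dim_row A)"
  unfolding coker_def Let_def A_RCOSETS_def' coker_map_def by (auto simp: module_vec_simps)

lemma coker_map_add: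
  assumes "v \<in> carrier_vec (dim_row A)" "w \<in> carrier_vec (dim_row A)"
  shows "coker_map A (v + w) = coker_map A v \<oplus>\<^bsub>coker A\<^esub> coker_map A w"
  using abelian_subgroup.a_rcos_sum[OF abelian_subgroup_mat_image, of v A w] assms
  by (simp add: coker_def Let_def coker_map_def module_vec_simps)

text \<open>Scaling a coset elementwise can give less than a coset, for instance when the scalar is
  0; the summand \<open>mat_image A\<close> in the scalar multiplication of \<open>coker\<close>
  restores the full coset.\<close>

lemma coker_map_smult:
  fixes A :: "'a::comm_ring_1 mat"
  assumes v: "v \<in> carrier_vec (dim_row A)"
  shows "coker_map A (c \<cdot>\<^sub>v v) = c \<odot>\<^bsub>coker A\<^esub> coker_map A v"
proof -
  have "(c \<odot>\<^bsub>coker A\<^esub> coker_map A v) = {u + c \<cdot>\<^sub>v (u' + v) | u u'. u \<in> mat_image A \<and> u' \<in> mat_image A}"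
    unfolding coker_def Let_def coker_map_eq by (auto simp: set_add_def' module_vec_simps)
  also have "\<dots> = coker_map A (c \<cdot>\<^sub>v v)"
  proof safe
    fix u u' assume u: "u \<in> mat_image A" "u' \<in> mat_image A"
    have "u + c \<cdot>\<^sub>v (u' + v) = (u + c \<cdot>\<^sub>v u') + c \<cdot>\<^sub>v v"
      using v mat_image_carrier[OF u(1)] mat_image_carrier[OF u(2)]
      by (intro eq_vecI) (auto simp: algebra_simps)
    then show "u + c \<cdot>\<^sub>v (u' + v) \<in> coker_map A (c \<cdot>\<^sub>v v)"
      using u by (auto simp: coker_map_eq intro: mat_image_add mat_image_smult)
  next
    fix z assume "z \<in> coker_map A (c \<cdot>\<^sub>v v)"
    then obtain u where u: "u \<in> mat_image A" "z = u + c \<cdot>\<^sub>v v"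
      by (auto simp: coker_map_eq)
    moreover have "0\<^sub>v (dim_row A) + v = v"
      using v by simp
    ultimately have "z = u + c \<cdot>\<^sub>v (0\<^sub>v (dim_row A) + v)"
      by simp
    then show "\<exists>u u'. z = u + c \<cdot>\<^sub>v (u' + v) \<and> u \<in> mat_image A \<and> u' \<in> mat_image A"
      using u mat_image_zero by blast
  qed
  finally show ?thesis ..
qed

lemma coker_zero: "\<zero>\<^bsub>coker A\<^esub> = coker_map A (0\<^sub>v (dim_row A))"
proof -
  have "(\<lambda>u. u + 0\<^sub>v (dim_row A)) ` mat_image A = (\<lambda>u. u) ` mat_image A"
    by (rule image_cong) (auto dest: mat_image_carrier)
  then show ?thesis
    by (simp add: coker_def Let_def coker_map_eq)
qed

text \<open>The laws descend from those of vectors, because \<open>coker_map\<close> is onto and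
  commutes with both operations. The case treated apart is the existence of negatives.\<close>

lemma module_coker:
  fixes A :: "'a::comm_ring_1 mat"
  assumes S: "closed_scalars S"
  shows "Module.module (scalars S) (coker A)"
proof (rule module_criteria[OF cring_scalars[OF S]], goal_cases)
  case 3
  have "\<exists>w\<in>carrier_vec (dim_row A). coker_map A (v + w) = coker_map A (0\<^sub>v (dim_row A))"
    if "v \<in> carrier_vec (dim_row A)" for v
    using that by (intro bexI[of _ "- v"]) auto
  then show ?case
    by (auto simp: carrier_coker coker_zero coker_map_add)
qed (auto simp: carrier_coker coker_zero scalars_def smult_smult_assoc add_smult_distrib_vec
    smult_add_distrib_vec comm_add_vec assoc_add_vec[of _ "dim_row A"]
    simp flip: coker_map_add coker_map_smult)

text \<open>A complement of the image is a set of unique representatives of the cosets. A trivial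
  intersection suffices for injectivity because the span is closed under differences.\<close>

lemma row_span_iso_cokerI:
  fixes A :: "'a::comm_ring_1 mat"
  assumes S: "closed_scalars S" and E: "dim_col E = dim_row A"
    and inj: "\<And>v. v \<in> row_span S E \<Longrightarrow> v \<in> mat_image A \<Longrightarrow> v = 0\<^sub>v (dim_row A)"
    and surj: "\<And>v. v \<in> carrier_vec (dim_row A) \<Longrightarrow> \<exists>w\<in>row_span S E. v - w \<in> mat_image A"
  shows "row_span_iso_coker S E A"
proof -
  let ?V = "module_vec TYPE('a) (dim_row A)" and ?W = "row_span S E"
  have W_eq: "?W = lin_combs S (dim_row A) {..<dim_row E} (\<lambda>i k. E $$ (i, k))"
    using S E by (rule row_span_eq_rows)
  have W: "LinearCombinations.submodule (scalars S) ?W ?V"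
    unfolding W_eq using S by (rule submodule_lin_combs)
  interpret W: LinearCombinations.submodule "scalars S" ?W ?V
    by (rule W)
  have W_carrier: "v \<in> carrier_vec (dim_row A)" if "v \<in> ?W" for v
    using W.subset that by (auto simp: module_vec_simps)
  have "Module.module (scalars S) (?V\<lparr>carrier := ?W\<rparr>)"
    using W module_scalars[OF S] by (rule LinearCombinations.module.submodule_is_module[rotated])
  moreover have "coker_map A \<in> LinearCombinations.module_hom (scalars S) (?V\<lparr>carrier := ?W\<rparr>) (coker A)"
    unfolding LinearCombinations.module_hom_def
    by (auto simp: carrier_coker coker_map_add coker_map_smult module_vec_simps W_carrier)
  ultimately have "mod_hom (scalars S) (?V\<lparr>carrier := ?W\<rparr>) (coker A) (coker_map A)"
    using module_coker[OF S] by (auto simp: mod_hom_def mod_hom_axioms_def)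
  moreover have "inj_on (coker_map A) ?W"
  proof (rule inj_onI)
    fix v w assume vw: "v \<in> ?W" "w \<in> ?W" and eq: "coker_map A v = coker_map A w"
    have "-1 \<in> carrier (scalars S)"
      using S by (auto simp: scalars_def closed_scalars_def)
    then have "v + (-1) \<cdot>\<^sub>v w \<in> ?W"
      using W.m_closed[OF vw(1) W.smult_closed[OF _ vw(2)], of "-1"] by (simp add: module_vec_simps)
    also have "v + (-1) \<cdot>\<^sub>v w = v - w"
      using W_carrier[OF vw(1)] W_carrier[OF vw(2)] by (intro eq_vecI) auto
    finally have "v - w = 0\<^sub>v (dim_row A)"
      using eq vw by (intro inj) (auto simp: coker_map_eq_iff W_carrier)
    then have "(v - w) $ i = 0" if "i < dim_row A" for i
      using that by simp
    then show "v = w"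
      using W_carrier[OF vw(1)] W_carrier[OF vw(2)] by (intro eq_vecI) auto
  qed
  moreover have "coker_map A ` ?W = carrier (coker A)"
  proof
    show "carrier (coker A) \<subseteq> coker_map A ` ?W"
    proof
      fix X assume "X \<in> carrier (coker A)"
      then obtain v where v: "v \<in> carrier_vec (dim_row A)" "X = coker_map A v"
        by (auto simp: carrier_coker)
      obtain w where w: "w \<in> ?W" "v - w \<in> mat_image A"
        using surj[OF v(1)] by blast
      then have "X = coker_map A w"
        using v coker_map_eq_iff[OF v(1) W_carrier[OF w(1)]] by simp
      then show "X \<in> coker_map A ` ?W"
        using w(1) by blast
    qed
  qed (auto simp: carrier_coker W_carrier)
  ultimately show ?thesis
    by (simp add: row_span_iso_coker_def bij_betw_def)
qed

section \<open>Evaluation at the roots\<close>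

lemma cyc_of_poly_eq_iff:
  "(cyc_of_poly p :: 'l::finite cyc) = cyc_of_poly q \<longleftrightarrow> [p = q] (mod cyc_modulus TYPE('l))"
  using Quotient3_rel_abs[OF Quotient3_cyc, of p q] Quotient3_rel[OF Quotient3_cyc, of p q]
  by (auto simp: cyc_of_poly_def cyc_rel_def)

lemma cyc_of_poly_rep: "cyc_of_poly (cyc_rep f) = f"
proof -
  have "cyc_of_poly (rep_cyc f) = f"
    unfolding cyc_of_poly_def by (rule Quotient3_abs_rep[OF Quotient3_cyc])
  moreover have "cyc_of_poly (cyc_rep f) = (cyc_of_poly (rep_cyc f) :: 'a cyc)"
    by (simp add: cyc_of_poly_eq_iff cyc_rep_def cong_def)
  ultimately show ?thesis
    by simp
qed

lemma cyc_of_poly_0: "cyc_of_poly 0 = 0"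
  and cyc_of_poly_1: "cyc_of_poly 1 = 1"
  and cyc_of_poly_add: "cyc_of_poly (p + q) = cyc_of_poly p + cyc_of_poly q"
  and cyc_of_poly_mult: "cyc_of_poly (p * q) = cyc_of_poly p * cyc_of_poly q"
  unfolding cyc_of_poly_def
  by (simp_all add: zero_cyc.abs_eq one_cyc.abs_eq plus_cyc.abs_eq times_cyc.abs_eq)

lemma cyc_rep_0: "cyc_rep 0 = 0"
  by (metis cyc_of_poly_0 cyc_rep_of_poly mod_0)

lemma cyc_rep_add: "cyc_rep (f + g) = cyc_rep f + cyc_rep g"
proof -
  have "cyc_rep f mod cyc_modulus TYPE('a) = cyc_rep f" for f :: "'a cyc"
    by (simp add: cyc_rep_def)
  then show ?thesis
    by (metis cyc_of_poly_add cyc_of_poly_rep cyc_rep_of_poly poly_mod_add_left)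
qed

lemma cyc_add_self: "f + f = (0 :: 'l::finite cyc)"
proof -
  have "p + p = 0" for p :: "bit poly"
  proof (rule poly_eqI)
    show "coeff (p + p) n = coeff 0 n" for n
      unfolding coeff_add by (cases "coeff p n") auto
  qed
  then show ?thesis
    by (metis cyc_of_poly_0 cyc_of_poly_add cyc_of_poly_rep)
qed

lemma closed_scalars_F2: "closed_scalars F2"
proof -
  have "- f = f" for f :: "'a cyc"
    using cyc_add_self[of f] by (metis eq_neg_iff_add_eq_0)
  moreover have "1 + 1 = (0 :: 'a cyc)"
    by (rule cyc_add_self)
  ultimately show ?thesis
    by (auto simp: closed_scalars_def F2_def simp del: one_add_one)
qed

lemma card_F2: "card F2 = 2"
  by (simp add: F2_def)

section \<open>Evaluation of binary polynomials in a field of characteristic 2\<close>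

context
  assumes char2: "CHAR('k::field) = 2"
begin

lemma two_eq_0: "(2 :: 'k) = 0"
  using of_nat_CHAR[where 'a = 'k] char2 by simp

lemma of_bit_add: "(of_bit (x + y) :: 'k) = of_bit x + of_bit y"
  using two_eq_0 by (cases x; cases y) auto

lemma of_bit_mult: "(of_bit (x * y) :: 'k) = of_bit x * of_bit y"
  by (cases x; cases y) auto

lemma eval_poly2_pCons: "eval_poly2 \<beta> (pCons a p) = of_bit a + (\<beta>::'k) * eval_poly2 \<beta> p"
  by (simp add: eval_poly2_def map_poly_pCons)

lemma eval_poly2_0: "eval_poly2 (\<beta>::'k) 0 = 0"
  by (simp add: eval_poly2_def)

lemma eval_poly2_1: "eval_poly2 (\<beta>::'k) 1 = 1"
  by (simp add: eval_poly2_def)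

lemma eval_poly2_add: "eval_poly2 (\<beta>::'k) (p + q) = eval_poly2 \<beta> p + eval_poly2 \<beta> q"
  by (induction p q rule: poly_induct2)
    (auto simp: eval_poly2_pCons of_bit_add eval_poly2_0 two_eq_0 algebra_simps)

lemma eval_poly2_mult: "eval_poly2 (\<beta>::'k) (p * q) = eval_poly2 \<beta> p * eval_poly2 \<beta> q"
proof (induction p)
  case (pCons a p)
  have "eval_poly2 \<beta> (Polynomial.smult a q) = of_bit a * eval_poly2 \<beta> q"
    by (cases a) (auto simp: eval_poly2_0)
  moreover have "eval_poly2 \<beta> (pCons 0 (p * q)) = \<beta> * eval_poly2 \<beta> (p * q)"
    by (simp add: eval_poly2_pCons)
  ultimately show ?case
    using pCons by (simp add: eval_poly2_pCons eval_poly2_add algebra_simps)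
qed (simp add: eval_poly2_0)

lemma eval_poly2_x: "eval_poly2 (\<beta>::'k) (monom 1 1) = \<beta>"
  using eval_poly2_pCons[of \<beta> 0 "[:1:]"] eval_poly2_pCons[of \<beta> 1 0]
  by (simp add: monom_altdef eval_poly2_0)

text \<open>Up to a unit, \<open>b\<close> is the minimal polynomial of \<beta>: a nonzero
  polynomial of least degree vanishing at \<beta> divides every other one by division with
  remainder, in particular \<open>b\<close>, and irreducibility makes the cofactor a unit.\<close>

lemma eval_poly2_eq_0_iff:
  assumes b: "irreducible b" "eval_poly2 (\<beta>::'k) b = 0"
  shows "eval_poly2 \<beta> p = 0 \<longleftrightarrow> b dvd p"
proof
  assume "b dvd p"
  then show "eval_poly2 \<beta> p = 0"
    using b(2) by (auto simp: eval_poly2_mult)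
next
  assume p: "eval_poly2 \<beta> p = 0"
  have "b \<noteq> 0"
    using b(1) by auto
  then obtain q where q: "q \<noteq> 0" "eval_poly2 \<beta> q = 0"
    and min: "\<And>r. r \<noteq> 0 \<Longrightarrow> eval_poly2 \<beta> r = 0 \<Longrightarrow> degree q \<le> degree r"
    using b(2) ex_has_least_nat[of "\<lambda>q. q \<noteq> 0 \<and> eval_poly2 \<beta> q = 0" b degree] by blast
  have q_dvd: "q dvd r" if "eval_poly2 \<beta> r = 0" for r
  proof (rule ccontr)
    assume "\<not> q dvd r"
    then have "r mod q \<noteq> 0"
      by (simp add: dvd_eq_mod_eq_0)
    moreover have "eval_poly2 \<beta> (q * (r div q) + r mod q) = 0"
      using that by simp
    then have "eval_poly2 \<beta> (r mod q) = 0"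
      using q(2) by (simp only: eval_poly2_add eval_poly2_mult) simp
    ultimately show False
      using min[of "r mod q"] degree_mod_less[OF q(1), of r] by simp
  qed
  obtain r where r: "b = q * r"
    using q_dvd[OF b(2)] by blast
  have "\<not> is_unit q"
  proof
    assume "is_unit q"
    then obtain q' where "1 = q * q'"
      by blast
    then have "eval_poly2 \<beta> 1 = eval_poly2 \<beta> q * eval_poly2 \<beta> q'"
      by (metis eval_poly2_mult)
    then show False
      using q(2) by (simp add: eval_poly2_1)
  qed
  then have "is_unit r"
    using b(1) r irreducibleD by blast
  then show "b dvd p"
    using q_dvd[OF p] r by (simp add: mult_unit_dvd_iff)
qed

lemma closed_scalars_Fq: "closed_scalars (Fq (\<beta>::'k))"
proof -
  have "- y = y" for y :: 'k
    using two_eq_0 by (simp add: neg_eq_iff_add_eq_0 flip: mult_2)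
  then have "- y \<in> Fq \<beta>" if "y \<in> Fq \<beta>" for y
    using that by metis
  then show ?thesis
    unfolding closed_scalars_def Fq_def
    by (auto simp flip: eval_poly2_add eval_poly2_mult
      simp: image_iff intro: exI[of _ 0] exI[of _ 1] simp: eval_poly2_0 eval_poly2_1)
qed

end

section \<open>The Chinese remainder isomorphism expressed by evaluations\<close>

locale crt_components =
  fixes t :: nat and b :: "nat \<Rightarrow> bit poly" and \<beta> :: "nat \<Rightarrow> 'k::field" and c :: "nat \<Rightarrow> 'l::finite cyc"
  assumes char2: "CHAR('k) = 2"
    and modulus: "cyc_modulus TYPE('l) = (\<Prod>i\<in>{1..t}. b i)"
    and irreducible: "\<And>i. i \<in> {1..t} \<Longrightarrow> irreducible (b i)"
    and root: "\<And>i. i \<in> {1..t} \<Longrightarrow> eval_poly2 (\<beta> i) (b i) = 0"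
    and c_cong_1: "\<And>i. i \<in> {1..t} \<Longrightarrow> [cyc_rep (c i) = 1] (mod b i)"
    and c_cong_0: "\<And>i j. i \<in> {1..t} \<Longrightarrow> j \<in> {1..t} \<Longrightarrow> j \<noteq> i \<Longrightarrow> [cyc_rep (c i) = 0] (mod b j)"
begin

lemma root_iff: "i \<in> {1..t} \<Longrightarrow> eval_poly2 (\<beta> i) p = 0 \<longleftrightarrow> b i dvd p"
  using eval_poly2_eq_0_iff[OF char2] irreducible root by blast

text \<open>Since \<beta> i is a root of the factor \<open>b i\<close>, it is a root of the modulus,
  and reduction does not change the value. This is what makes \<open>ev\<close> a ring
  homomorphism.\<close>

lemma ev_of_poly:
  assumes "i \<in> {1..t}"
  shows "ev (\<beta> i) (cyc_of_poly p :: 'l cyc) = eval_poly2 (\<beta> i) p"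
proof -
  let ?m = "cyc_modulus TYPE('l)"
  have "b i dvd ?m"
    unfolding modulus using assms by (intro dvd_prodI) auto
  then have "eval_poly2 (\<beta> i) ?m = 0"
    using assms by (simp add: root_iff)
  then have "eval_poly2 (\<beta> i) (?m * (p div ?m) + p mod ?m) = eval_poly2 (\<beta> i) (p mod ?m)"
    by (simp only: eval_poly2_add[OF char2] eval_poly2_mult[OF char2]) simp
  then show ?thesis
    by (simp add: ev_def cyc_rep_of_poly)
qed

context
  fixes i assumes i: "i \<in> {1..t}"
begin

lemma ev_0: "ev (\<beta> i) (0 :: 'l cyc) = 0"
  and ev_1: "ev (\<beta> i) (1 :: 'l cyc) = 1"
  and ev_x: "ev (\<beta> i) (cyc_x :: 'l cyc) = \<beta> i"
  unfolding cyc_x_def cyc_of_poly_0[symmetric] cyc_of_poly_1[symmetric] ev_of_poly[OF i]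
  using char2 by (simp_all add: eval_poly2_0 eval_poly2_1 eval_poly2_x del: One_nat_def)

lemma ev_add: "ev (\<beta> i) (f + g :: 'l cyc) = ev (\<beta> i) f + ev (\<beta> i) g"
  and ev_mult: "ev (\<beta> i) (f * g :: 'l cyc) = ev (\<beta> i) f * ev (\<beta> i) g"
  by (metis char2 cyc_of_poly_rep cyc_of_poly_add ev_of_poly[OF i] eval_poly2_add,
      metis char2 cyc_of_poly_rep cyc_of_poly_mult ev_of_poly[OF i] eval_poly2_mult)

lemma ev_minus: "ev (\<beta> i) (f - g :: 'l cyc) = ev (\<beta> i) f - ev (\<beta> i) g"
  using ev_add[of "f - g" g] by simp

lemma ev_sum: "ev (\<beta> i) (\<Sum>p\<in>P. f p :: 'l cyc) = (\<Sum>p\<in>P. ev (\<beta> i) (f p))"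
  by (induction P rule: infinite_finite_induct) (auto simp: ev_0 ev_add)

lemma ev_power: "ev (\<beta> i) (f ^ n :: 'l cyc) = ev (\<beta> i) f ^ n"
  by (induction n) (auto simp: ev_1 ev_mult)

lemma ev_in_Fq: "ev (\<beta> i) (f :: 'l cyc) \<in> Fq (\<beta> i)"
  by (simp add: ev_def Fq_def)

lemma Fq_eq_range_ev: "Fq (\<beta> i) = range (ev (\<beta> i) :: 'l cyc \<Rightarrow> 'k)"
  unfolding Fq_def using ev_of_poly[OF i] by (auto simp: ev_def image_iff) metis

lemma ev_c: "j \<in> {1..t} \<Longrightarrow> ev (\<beta> i) (c j) = (if i = j then 1 else 0)"
proof -
  assume j: "j \<in> {1..t}"
  show ?thesis
  proof (cases "i = j")
    case True
    have "b i dvd cyc_rep (c i) - 1"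
      using c_cong_1[OF i] by (simp add: cong_iff_dvd_diff)
    then have "eval_poly2 (\<beta> i) (cyc_rep (c i) - 1) = 0"
      by (simp add: root_iff[OF i])
    then have "eval_poly2 (\<beta> i) (cyc_rep (c i) - 1 + 1) = 1"
      by (simp only: eval_poly2_add[OF char2] eval_poly2_1[OF char2]) simp
    then show ?thesis
      using True by (simp add: ev_def)
  next
    case False
    then have "b i dvd cyc_rep (c j)"
      using c_cong_0[OF j i] by (simp add: cong_0_iff)
    then show ?thesis
      using False by (simp add: ev_def root_iff[OF i])
  qed
qed

end

text \<open>The representative of the difference vanishes at every root, hence is divisible by each
  factor and by their product, the modulus. Vanishing at \<beta> j replaces divisibility by
  \<open>b j\<close>, so the primality needed comes from the absence of zero divisors in the
  field.\<close>

lemma ev_eqI: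
  fixes f g :: "'l cyc"
  assumes eq: "\<And>i. i \<in> {1..t} \<Longrightarrow> ev (\<beta> i) f = ev (\<beta> i) g"
  shows "f = g"
proof -
  let ?p = "cyc_rep (f - g)"
  have root_p: "eval_poly2 (\<beta> i) ?p = 0" if "i \<in> {1..t}" for i
    using ev_minus[OF that, of f g] eq[OF that] by (simp add: ev_def)
  have "(\<Prod>i\<in>J. b i) dvd ?p" if "J \<subseteq> {1..t}" for J
    using finite_subset[OF that finite_atLeastAtMost] that
  proof (induction J rule: finite_induct)
    case (insert j J)
    then have j: "j \<in> {1..t}" and J: "J \<subseteq> {1..t}"
      by auto
    obtain q where q: "?p = prod b J * q"
      using insert J by auto
    \<comment> \<open>Otherwise \<open>b j\<close> would divide another factor \<open>b i\<close>;
      then \<open>c j\<close>, being 0 modulo \<open>b i\<close>, would vanish at \<beta> j, where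
      its value is 1.\<close>
    have "\<not> b j dvd prod b J"
    proof
      assume "b j dvd prod b J"
      then have "eval_poly2 (\<beta> j) (prod b J) = 0"
        using j by (simp add: root_iff)
      moreover have "eval_poly2 (\<beta> j) (prod b J) = (\<Prod>i\<in>J. eval_poly2 (\<beta> j) (b i))"
        by (induction J rule: infinite_finite_induct)
          (auto simp: eval_poly2_1[OF char2] eval_poly2_mult[OF char2])
      ultimately obtain i where i: "i \<in> J" "b j dvd b i"
        using insert.hyps j by (auto simp: root_iff)
      then have "i \<in> {1..t}" "i \<noteq> j"
        using J insert.hyps by auto
      then have "b j dvd cyc_rep (c j)"
        using c_cong_0[OF j] i(2) by (auto simp: cong_0_iff intro: dvd_trans)
      then show False
        using ev_c[OF j j] j by (simp add: ev_def flip: root_iff)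
    qed
    then have "b j dvd q"
      using root_p[OF j] q j by (simp add: eval_poly2_mult[OF char2] flip: root_iff)
    then show ?case
      using insert.hyps q by (simp add: mult.commute mult_dvd_mono)
  qed simp
  then have "cyc_modulus TYPE('l) dvd ?p"
    unfolding modulus by simp
  moreover have "?p mod cyc_modulus TYPE('l) = ?p"
    by (simp add: cyc_rep_def)
  ultimately have "?p = 0"
    by (simp add: dvd_eq_mod_eq_0)
  then have "f - g = 0"
    by (metis cyc_of_poly_0 cyc_of_poly_rep)
  then show ?thesis
    by simp
qed

text \<open>A multiple of \<open>c i\<close> vanishes at all other roots, so its value at \<beta> i
  determines it and the inverse is well defined; for \<open>y = ev (\<beta> i) f\<close> it is
  \<open>c i * f\<close>.\<close>

lemma ev_ev_inv:
  assumes i: "i \<in> {1..t}" and j: "j \<in> {1..t}" and y: "y \<in> Fq (\<beta> i)"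
  shows "ev (\<beta> j) (ev_inv (c i) (\<beta> i) y) = (if i = j then y else 0)"
proof -
  obtain f :: "'l cyc" where f: "y = ev (\<beta> i) f"
    using y by (auto simp: Fq_eq_range_ev[OF i])
  have "inj_on (ev (\<beta> i)) (range ((*) (c i)))"
  proof (rule inj_onI, safe)
    fix g h assume eq: "ev (\<beta> i) (c i * g) = ev (\<beta> i) (c i * h)"
    show "c i * g = c i * h"
    proof (rule ev_eqI)
      fix j assume "j \<in> {1..t}"
      then show "ev (\<beta> j) (c i * g) = ev (\<beta> j) (c i * h)"
        using eq i by (cases "j = i") (auto simp: ev_mult ev_c)
    qed
  qed
  moreover have "y = ev (\<beta> i) (c i * f)"
    using i by (simp add: f ev_mult ev_c)
  ultimately have "ev_inv (c i) (\<beta> i) y = c i * f"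
    unfolding ev_inv_def by (simp add: the_inv_into_f_f)
  then show ?thesis
    using i j by (simp add: f ev_mult ev_c)
qed

end

section \<open>Combinations of lifted vectors, one component at a time\<close>

context crt_components
begin

text \<open>Vectors lifted from the other components vanish at \<beta> i, so only the block
  \<open>i' = i\<close> survives. The inner sum over \<open>q\<close> collects the digits of a
  single coefficient with respect to the values of \<open>u i q\<close>.\<close>

lemma ev_component_sum:
  fixes I :: "nat \<Rightarrow> nat set" and d :: "nat \<Rightarrow> nat"
  assumes i: "i \<in> {1..t}" and I: "\<And>i. i \<in> {1..t} \<Longrightarrow> finite (I i)"
    and w: "\<And>i' j. i' \<in> {1..t} \<Longrightarrow> j \<in> I i' \<Longrightarrow>
       ev (\<beta> i) (w i' j :: 'l cyc) = (if i' = i then z i' j else 0)"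
  shows "ev (\<beta> i) (\<Sum>p\<in>(SIGMA i:{1..t}. I i \<times> {..<d i}).
             a p * (case p of (i, j, q) \<Rightarrow> u i q * w i j))
         = (\<Sum>j\<in>I i. (\<Sum>q<d i. ev (\<beta> i) (a (i, j, q) * u i q)) * z i j)"
proof -
  have "ev (\<beta> i) (\<Sum>p\<in>(SIGMA i:{1..t}. I i \<times> {..<d i}).
             a p * (case p of (i, j, q) \<Rightarrow> u i q * w i j))
       = (\<Sum>i'\<in>{1..t}. \<Sum>(j, q)\<in>I i' \<times> {..<d i'}.
            ev (\<beta> i) (a (i', j, q) * u i' q) * ev (\<beta> i) (w i' j))"
    using i I by (subst sum.Sigma) (auto simp: ev_sum ev_mult mult.assoc intro!: sum.cong finite_cartesian_product)
  also have "\<dots> = (\<Sum>i'\<in>{1..t}. if i' = i then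
      (\<Sum>(j, q)\<in>I i \<times> {..<d i}. ev (\<beta> i) (a (i, j, q) * u i q) * z i j) else 0)"
    by (rule sum.cong) (auto simp: w intro!: sum.cong sum.neutral)
  also have "\<dots> = (\<Sum>(j, q)\<in>I i \<times> {..<d i}. ev (\<beta> i) (a (i, j, q) * u i q) * z i j)"
    using i by simp
  also have "\<dots> = (\<Sum>j\<in>I i. (\<Sum>q<d i. ev (\<beta> i) (a (i, j, q) * u i q)) * z i j)"
    by (simp add: sum.cartesian_product sum_distrib_right)
  finally show ?thesis .
qed

text \<open>The vectors \<open>w i j\<close> lift \<open>z i j\<close> to \<open>R\<close>, concentrated in the component \<open>i\<close>. The vectors \<open>z i j\<close>
  are systematic generators for \<open>G\<^sub>A\<close> and \<open>G\<^bsub>A*\<^esub>\<close>, and unit vectors for \<open>E\<^sub>A\<close> and \<open>E\<^bsub>A*\<^esub>\<close>;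
  the matrices generating over \<open>R\<close> have \<open>d i = 1\<close> and \<open>u i 0 = 1\<close>.\<close>

lemma
  fixes w :: "nat \<Rightarrow> nat \<Rightarrow> nat \<Rightarrow> 'l cyc" and I :: "nat \<Rightarrow> nat set" and d :: "nat \<Rightarrow> nat"
  assumes I: "\<And>i. i \<in> {1..t} \<Longrightarrow> I i \<subseteq> {0..<n}"
    and z: "\<And>i j j'. i \<in> {1..t} \<Longrightarrow> j \<in> I i \<Longrightarrow> j' \<in> I i \<Longrightarrow> z i j j' = (if j = j' then 1 else 0)"
    and w: "\<And>i i' j k. i \<in> {1..t} \<Longrightarrow> i' \<in> {1..t} \<Longrightarrow> j \<in> I i' \<Longrightarrow> k < n \<Longrightarrow>
       ev (\<beta> i) (w i' j k) = (if i' = i then z i' j k else 0)"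
  shows lin_combs_components:
      "(\<And>i y. i \<in> {1..t} \<Longrightarrow> y \<in> Fq (\<beta> i) \<Longrightarrow>
         \<exists>a. (\<forall>q<d i. a q \<in> S) \<and> y = (\<Sum>q<d i. ev (\<beta> i) (a q * u i q))) \<Longrightarrow>
       lin_combs S n (SIGMA i:{1..t}. I i \<times> {..<d i}) (\<lambda>(i, j, q) k. u i q * w i j k)
         = {v \<in> carrier_vec n. \<forall>i\<in>{1..t}. \<forall>k<n.
              ev (\<beta> i) (v $ k) = (\<Sum>j\<in>I i. ev (\<beta> i) (v $ j) * z i j k)}"
    and card_lin_combs_components:
      "(\<And>i a a'. i \<in> {1..t} \<Longrightarrow> \<forall>q<d i. a q \<in> S \<and> a' q \<in> S \<Longrightarrow>
         (\<Sum>q<d i. ev (\<beta> i) (a q * u i q)) = (\<Sum>q<d i. ev (\<beta> i) (a' q * u i q)) \<Longrightarrow>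
         \<forall>q<d i. a q = a' q) \<Longrightarrow>
       card (lin_combs S n (SIGMA i:{1..t}. I i \<times> {..<d i}) (\<lambda>(i, j, q) k. u i q * w i j k))
         = card S ^ card (SIGMA i:{1..t}. I i \<times> {..<d i})"
proof -
  let ?P = "SIGMA i:{1..t}. I i \<times> {..<d i}"
  let ?f = "\<lambda>(i, j, q) k. u i q * w i j k"
  have fin: "finite (I i)" if "i \<in> {1..t}" for i
    using I[OF that] finite_subset by blast
  have f: "?f p k = (case p of (i, j, q) \<Rightarrow> u i q * w i j k)" for p k
    by (cases p) auto
  have ev_comb: "ev (\<beta> i) (\<Sum>p\<in>?P. a p * ?f p k)
      = (\<Sum>j\<in>I i. (\<Sum>q<d i. ev (\<beta> i) (a (i, j, q) * u i q)) * z i j k)"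
    if "i \<in> {1..t}" "k < n" for a i k
    unfolding f using that fin w by (intro ev_component_sum) auto
  \<comment> \<open>On \<open>I i\<close> the vectors \<open>z i j\<close> form an identity matrix,
    so each coordinate there shows exactly one digit sum. Both the span and the independence claim
    are read off from these coordinates.\<close>
  have ev_comb_I: "ev (\<beta> i) (\<Sum>p\<in>?P. a p * ?f p j)
      = (\<Sum>q<d i. ev (\<beta> i) (a (i, j, q) * u i q))" if "i \<in> {1..t}" "j \<in> I i" for a i j
  proof -
    have "j < n"
      using that I by force
    then have "ev (\<beta> i) (\<Sum>p\<in>?P. a p * ?f p j)
        = (\<Sum>j'\<in>I i. (\<Sum>q<d i. ev (\<beta> i) (a (i, j', q) * u i q)) * z i j' j)"
      using that(1) by (rule ev_comb[rotated])
    also have "\<dots> = (\<Sum>j'\<in>I i. if j' = j then \<Sum>q<d i. ev (\<beta> i) (a (i, j', q) * u i q) else 0)"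
      using that z by (intro sum.cong) auto
    finally show ?thesis
      using that fin by simp
  qed
  show "lin_combs S n ?P ?f = {v \<in> carrier_vec n. \<forall>i\<in>{1..t}. \<forall>k<n.
      ev (\<beta> i) (v $ k) = (\<Sum>j\<in>I i. ev (\<beta> i) (v $ j) * z i j k)}" (is "?L = ?R")
    if span: "\<And>i y. i \<in> {1..t} \<Longrightarrow> y \<in> Fq (\<beta> i) \<Longrightarrow>
         \<exists>a. (\<forall>q<d i. a q \<in> S) \<and> y = (\<Sum>q<d i. ev (\<beta> i) (a q * u i q))"
  proof (rule equalityI; rule subsetI)
    fix v assume "v \<in> ?L"
    then obtain a where v: "v \<in> carrier_vec n" "\<forall>k<n. v $ k = (\<Sum>p\<in>?P. a p * ?f p k)"
      by (auto simp: lin_combs_iff)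
    have "ev (\<beta> i) (v $ k) = (\<Sum>j\<in>I i. ev (\<beta> i) (v $ j) * z i j k)"
      if "i \<in> {1..t}" "k < n" for i k
    proof -
      have "v $ j = (\<Sum>p\<in>?P. a p * ?f p j)" if "j \<in> I i" for j
        using that v(2) I[OF \<open>i \<in> {1..t}\<close>] by force
      then have "ev (\<beta> i) (v $ j) = (\<Sum>q<d i. ev (\<beta> i) (a (i, j, q) * u i q))" if "j \<in> I i" for j
        using ev_comb_I[OF \<open>i \<in> {1..t}\<close> that] that by simp
      then show ?thesis
        using v(2) that ev_comb[OF that] by simp
    qed
    then show "v \<in> ?R"
      using v(1) by blast
  next
    fix v assume "v \<in> ?R"
    then have v: "v \<in> carrier_vec n" "\<And>i k. i \<in> {1..t} \<Longrightarrow> k < n \<Longrightarrow>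
        ev (\<beta> i) (v $ k) = (\<Sum>j\<in>I i. ev (\<beta> i) (v $ j) * z i j k)"
      by blast+
    \<comment> \<open>The digits of the coordinates of \<open>v\<close> are the only possible
      coefficients; outside \<open>I i\<close> the combination agrees with \<open>v\<close> by the
      relation defining the right-hand side.\<close>
    have "\<forall>i j. \<exists>a. i \<in> {1..t} \<longrightarrow>
        (\<forall>q<d i. a q \<in> S) \<and> ev (\<beta> i) (v $ j) = (\<Sum>q<d i. ev (\<beta> i) (a q * u i q))"
      using span ev_in_Fq by blast
    then obtain a where a: "\<And>i j q. i \<in> {1..t} \<Longrightarrow> q < d i \<Longrightarrow> a i j q \<in> S"
      "\<And>i j. i \<in> {1..t} \<Longrightarrow> ev (\<beta> i) (v $ j) = (\<Sum>q<d i. ev (\<beta> i) (a i j q * u i q))"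
      by metis
    show "v \<in> ?L"
    proof (rule lin_combsI[where a = "\<lambda>(i, j, q). a i j q"])
      fix k assume "k < n"
      show "v $ k = (\<Sum>p\<in>?P. (case p of (i, j, q) \<Rightarrow> a i j q) * ?f p k)"
      proof (rule ev_eqI)
        fix i assume "i \<in> {1..t}"
        then show "ev (\<beta> i) (v $ k) = ev (\<beta> i) (\<Sum>p\<in>?P. (case p of (i, j, q) \<Rightarrow> a i j q) * ?f p k)"
          using \<open>k < n\<close> by (simp only: ev_comb v(2) a(2) prod.case)
      qed
    qed (use v(1) a(1) in auto)
  qed
  show "card (lin_combs S n ?P ?f) = card S ^ card ?P"
    if indep: "\<And>i a a'. i \<in> {1..t} \<Longrightarrow> \<forall>q<d i. a q \<in> S \<and> a' q \<in> S \<Longrightarrow>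
         (\<Sum>q<d i. ev (\<beta> i) (a q * u i q)) = (\<Sum>q<d i. ev (\<beta> i) (a' q * u i q)) \<Longrightarrow>
         \<forall>q<d i. a q = a' q"
  proof (rule card_lin_combs)
    show "finite ?P"
      using fin by auto
    fix a a' assume S: "a \<in> ?P \<rightarrow> S" "a' \<in> ?P \<rightarrow> S"
      and eq: "\<And>k. k < n \<Longrightarrow> (\<Sum>p\<in>?P. a p * ?f p k) = (\<Sum>p\<in>?P. a' p * ?f p k)"
    show "\<forall>p\<in>?P. a p = a' p"
    proof (safe, goal_cases)
      case (1 i j q)
      then have i: "i \<in> {1..t}" and "j < n"
        using I by force+
      have "(\<Sum>q<d i. ev (\<beta> i) (a (i, j, q) * u i q)) = (\<Sum>q<d i. ev (\<beta> i) (a' (i, j, q) * u i q))"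
        unfolding ev_comb_I[OF i 1(2), symmetric] eq[OF \<open>j < n\<close>] ..
      then have "\<forall>q<d i. a (i, j, q) = a' (i, j, q)"
        using S 1 by (intro indep[OF i]) auto
      then show ?case
        using 1 by blast
    qed
  qed
qed

end

section \<open>Systematic generators over a finite subfield\<close>

lemma sum_mem_closed_scalars:
  assumes "closed_scalars F" "\<And>p. p \<in> P \<Longrightarrow> f p \<in> F"
  shows "sum f P \<in> F"
  using assms(2)
  by (induction P rule: infinite_finite_induct) (use assms(1) in \<open>auto simp: closed_scalars_def\<close>)

text \<open>Multiplication by a nonzero element is injective on the finite set \<open>F\<close>,
  hence onto, and therefore hits 1. So a finite subring of a field is a subfield.\<close>

lemma inverse_mem_closed_scalars:
  fixes F :: "'k::field set"
  assumes F: "closed_scalars F" "finite F" and y: "y \<in> F"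
  shows "inverse y \<in> F"
proof (cases "y = 0")
  case False
  then have "inj_on ((*) y) F"
    by (auto intro: inj_onI)
  moreover have "(*) y ` F \<subseteq> F"
    using F(1) y by (auto simp: closed_scalars_def)
  ultimately have "(*) y ` F = F"
    using F(2) by (intro endo_inj_surj)
  then obtain z where "z \<in> F" "1 = y * z"
    using F(1) unfolding closed_scalars_def by (metis imageE)
  then show ?thesis
    by (metis inverse_unique)
qed (use y in simp)

text \<open>This is the Fredholm alternative with all data and all solutions inside
  \<open>F\<close>: either \<open>v\<close> is a combination of the rows, or some functional kills
  the rows and is 1 on \<open>v\<close>. Induction on the number of rows needs no notion of rank or
  dimension.\<close>

lemma separating_functional:
  fixes F :: "'k::field set" and a :: "nat \<Rightarrow> nat \<Rightarrow> 'k"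
  assumes F: "closed_scalars F" "finite F"
    and a: "\<And>j k. j < m \<Longrightarrow> k < n \<Longrightarrow> a j k \<in> F" and v: "\<And>k. k < n \<Longrightarrow> v k \<in> F"
  shows "(\<exists>x. (\<forall>j<m. x j \<in> F) \<and> (\<forall>k<n. v k = (\<Sum>j<m. x j * a j k))) \<or>
         (\<exists>y. (\<forall>k<n. y k \<in> F) \<and> (\<forall>j<m. (\<Sum>k<n. y k * a j k) = 0) \<and> (\<Sum>k<n. y k * v k) = 1)"
  using a v
proof (induction m arbitrary: v)
  case 0
  show ?case
  proof (cases "\<forall>k<n. v k = 0")
    case False
    then obtain k where k: "k < n" "v k \<noteq> 0"
      by blast
    let ?y = "\<lambda>k'. if k' = k then inverse (v k) else 0"
    have "\<forall>k<n. ?y k \<in> F"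
      using F 0 k inverse_mem_closed_scalars[OF F] by (auto simp: closed_scalars_def)
    moreover have "(\<Sum>k<n. ?y k * v k) = 1"
      using k by (simp add: if_distrib[of "\<lambda>x. x * _"] cong: if_cong)
    ultimately show ?thesis
      by (intro disjI2 exI[of _ ?y]) simp
  qed simp
next
  case (Suc m)
  have mem: "x + y \<in> F" "x * y \<in> F" "- x \<in> F" "x - y \<in> F" if "x \<in> F" "y \<in> F" for x y
    using F(1) that unfolding closed_scalars_def by (auto, metis add_uminus_conv_diff)
  let ?span = "\<lambda>m v. \<exists>x. (\<forall>j<m. x j \<in> F) \<and> (\<forall>k<n. v k = (\<Sum>j<m. x j * a j k))"
  have aF: "\<And>j k. j < m \<Longrightarrow> k < n \<Longrightarrow> a j k \<in> F" "\<And>k. k < n \<Longrightarrow> a m k \<in> F"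
    using Suc.prems(1) by auto
  \<comment> \<open>Applied to the new row itself, the induction hypothesis decides whether the row
    is redundant or there is a functional that kills the old rows and is normalised to 1 on
    it.\<close>
  consider "?span m (a m)" | y where "\<forall>k<n. y k \<in> F" "\<forall>j<m. (\<Sum>k<n. y k * a j k) = 0"
      "(\<Sum>k<n. y k * a m k) = 1"
    using Suc.IH[of "a m"] aF by blast
  then show ?case
  proof cases
    case 1
    then obtain r where r: "\<forall>j<m. r j \<in> F" "\<forall>k<n. a m k = (\<Sum>j<m. r j * a j k)"
      by blast
    consider "?span m v" | y where "\<forall>k<n. y k \<in> F" "\<forall>j<m. (\<Sum>k<n. y k * a j k) = 0"
        "(\<Sum>k<n. y k * v k) = 1"
      using Suc.IH[of v] aF Suc.prems(2) by blast
    then show ?thesis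
    proof cases
      case 1
      then obtain x where "\<forall>j<m. x j \<in> F" "\<forall>k<n. v k = (\<Sum>j<m. x j * a j k)"
        by blast
      then show ?thesis
        using F(1) by (intro disjI1 exI[of _ "x(m := 0)"]) (auto simp: closed_scalars_def less_Suc_eq)
    next
      case 2
      have "(\<Sum>k<n. y k * a m k) = (\<Sum>k<n. \<Sum>j<m. r j * (y k * a j k))"
        using r(2) by (intro sum.cong) (auto simp: sum_distrib_left mult.left_commute)
      also have "\<dots> = (\<Sum>j<m. r j * (\<Sum>k<n. y k * a j k))"
        by (subst sum.swap) (simp add: sum_distrib_left)
      also have "\<dots> = 0"
        using 2 by simp
      finally show ?thesis
        using 2 by (intro disjI2 exI[of _ y]) (auto simp: less_Suc_eq)
    qed
  next
    case (2 y0)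
    \<comment> \<open>The only coefficient with which subtracting the new row from \<open>v\<close>
      leaves a vector killed by \<open>y0\<close>.\<close>
    define s where "s = (\<Sum>k<n. y0 k * v k)"
    have s: "s \<in> F"
      unfolding s_def using 2 Suc.prems(2) mem by (intro sum_mem_closed_scalars[OF F(1)]) auto
    let ?v = "\<lambda>k. v k - s * a m k"
    have "\<And>k. k < n \<Longrightarrow> ?v k \<in> F"
      using s aF Suc.prems(2) mem by auto
    then consider "?span m ?v" | y where "\<forall>k<n. y k \<in> F" "\<forall>j<m. (\<Sum>k<n. y k * a j k) = 0"
        "(\<Sum>k<n. y k * ?v k) = 1"
      using Suc.IH[of ?v] aF by blast
    then show ?thesis
    proof cases
      case 1
      then obtain x where x: "\<forall>j<m. x j \<in> F" "\<forall>k<n. ?v k = (\<Sum>j<m. x j * a j k)"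
        by blast
      have "v k = (\<Sum>j<m. x j * a j k) + s * a m k" if "k < n" for k
        using x(2) that by (metis diff_add_cancel)
      then show ?thesis
        using x(1) s by (intro disjI1 exI[of _ "x(m := s)"]) (auto simp: less_Suc_eq)
    next
      case (2 y1)
      \<comment> \<open>The functional \<open>y1\<close> separates the corrected vector from the old
        rows but may be nonzero on the new one. Subtracting \<open>r\<close> times \<open>y0\<close>
        kills that row, and since \<open>y0\<close> vanishes on the corrected vector, the value 1 is
        carried over to \<open>v\<close>.\<close>
      define r where "r = (\<Sum>k<n. y1 k * a m k)"
      have r: "r \<in> F"
        unfolding r_def using 2 aF mem by (intro sum_mem_closed_scalars[OF F(1)]) auto
      let ?y = "\<lambda>k. y1 k - r * y0 k"
      have y: "(\<Sum>k<n. ?y k * w k) = (\<Sum>k<n. y1 k * w k) - r * (\<Sum>k<n. y0 k * w k)" for w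
        by (simp add: sum_distrib_left left_diff_distrib sum_subtractf mult.assoc)
      have "(\<Sum>k<n. y1 k * ?v k) = (\<Sum>k<n. y1 k * v k) - s * r"
        by (simp add: r_def sum_distrib_left right_diff_distrib sum_subtractf mult.left_commute)
      then have "(\<Sum>k<n. ?y k * v k) = 1"
        using 2 unfolding y s_def[symmetric] by (simp add: mult.commute[of r s])
      moreover have "\<forall>j<Suc m. (\<Sum>k<n. ?y k * a j k) = 0"
        using 2 \<open>\<forall>j<m. (\<Sum>k<n. y0 k * a j k) = 0\<close> \<open>(\<Sum>k<n. y0 k * a m k) = 1\<close>
        unfolding y by (auto simp: less_Suc_eq simp flip: r_def)
      moreover have "\<forall>k<n. ?y k \<in> F"
        using 2(1) \<open>\<forall>k<n. y0 k \<in> F\<close> r mem by auto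
      ultimately show ?thesis
        by (intro disjI2 exI[of _ ?y]) auto
    qed
  qed
qed

lemma ker_over_iff:
  assumes "B \<in> carrier_mat m n"
  shows "v \<in> ker_over F B \<longleftrightarrow> v \<in> carrier_vec n \<and> (\<forall>k<n. v $ k \<in> F) \<and>
    (\<forall>r<m. (\<Sum>k<n. B $$ (r, k) * v $ k) = 0)"
proof -
  have "(B *\<^sub>v v) $ r = (\<Sum>k<n. B $$ (r, k) * v $ k)" if "r < m" "v \<in> carrier_vec n" for r
    using that assms by (auto simp: scalar_prod_def atLeast0LessThan intro!: sum.cong)
  moreover have "set\<^sub>v v \<subseteq> F \<longleftrightarrow> (\<forall>k<n. v $ k \<in> F)" if "v \<in> carrier_vec n"
    using that by (auto simp: vec_set_def)
  ultimately show ?thesis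
    using assms unfolding ker_over_def mat_kernel_def by (auto simp: vec_eq_iff)
qed

text \<open>Restricted to \<open>I\<close>, the generators are unit vectors, so the coefficients of
  a codeword can only be its own coordinates on \<open>I\<close>. Membership in the kernel thus
  becomes a formula without an existential quantifier, which can be compared across
  components.\<close>

lemma
  fixes F :: "'k::field set"
  assumes F: "closed_scalars F" and B: "B \<in> carrier_mat m n" and I: "I \<subseteq> {0..<n}"
    and g: "systematic_generator F n (ker_over F B) I g"
  shows systematic_generator_mem: "j \<in> I \<Longrightarrow> g j \<in> ker_over F B"
    and ker_over_iff_systematic:
      "v \<in> carrier_vec n \<Longrightarrow> \<forall>k<n. v $ k \<in> F \<Longrightarrow>
       v \<in> ker_over F B \<longleftrightarrow> (\<forall>k<n. v $ k = (\<Sum>j\<in>I. v $ j * g j $ k))"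
proof -
  have fin: "finite I"
    using I finite_subset by blast
  have gn: "g j \<in> carrier_vec n" if "j \<in> I" for j
    using g that by (auto simp: systematic_generator_def)
  have "row_span F (mat_of_rows n (map g (sorted_list_of_set I))) = lin_combs F n I (\<lambda>j k. g j $ k)"
  proof (rule row_span_mat_of_rows[OF F fin])
    show "set (map g (sorted_list_of_set I)) = (\<lambda>j. vec n (\<lambda>k. g j $ k)) ` I"
      using fin gn by (auto intro!: image_cong)
  qed
  then have C: "ker_over F B = lin_combs F n I (\<lambda>j k. g j $ k)"
    using g by (simp add: systematic_generator_def)
  show mem: "g j \<in> ker_over F B" if "j \<in> I" for j
    unfolding C using that fin gn F
    by (intro lin_combsI[where a = "\<lambda>j'. if j' = j then 1 else 0"])
      (auto simp: closed_scalars_def if_distrib[of "\<lambda>x. x * _"] cong: if_cong)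
  show "v \<in> ker_over F B \<longleftrightarrow> (\<forall>k<n. v $ k = (\<Sum>j\<in>I. v $ j * g j $ k))"
    if v: "v \<in> carrier_vec n" "\<forall>k<n. v $ k \<in> F"
  proof
    assume "v \<in> ker_over F B"
    then obtain a where a: "\<forall>k<n. v $ k = (\<Sum>j\<in>I. a j * g j $ k)"
      unfolding C by (auto simp: lin_combs_iff)
    have "v $ j = a j" if j: "j \<in> I" for j
    proof -
      have "v $ j = (\<Sum>j'\<in>I. a j' * g j' $ j)"
        using a j I by force
      also have "\<dots> = (\<Sum>j'\<in>I. if j' = j then a j' else 0)"
        using g j by (intro sum.cong) (auto simp: systematic_generator_def)
      finally show ?thesis
        using fin j by simp
    qed
    then show "\<forall>k<n. v $ k = (\<Sum>j\<in>I. v $ j * g j $ k)"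
      using a by simp
  next
    assume "\<forall>k<n. v $ k = (\<Sum>j\<in>I. v $ j * g j $ k)"
    then show "v \<in> ker_over F B"
      unfolding C using v I by (intro lin_combsI[where a = "\<lambda>j. v $ j"]) auto
  qed
qed

section \<open>Kernels and images through their components\<close>

context crt_components
begin

text \<open>The surjective half of the Chinese remainder theorem: each lift is seen only by its own
  component, so the sum of lifts has prescribed values.\<close>

lemma ev_glue:
  assumes i: "i \<in> {1..t}" and y: "\<And>i. i \<in> {1..t} \<Longrightarrow> y i \<in> Fq (\<beta> i)"
  shows "ev (\<beta> i) (\<Sum>i'\<in>{1..t}. ev_inv (c i') (\<beta> i') (y i')) = y i"
proof -
  have "ev (\<beta> i) (\<Sum>i'\<in>{1..t}. ev_inv (c i') (\<beta> i') (y i')) = (\<Sum>i'\<in>{1..t}. if i' = i then y i' else 0)"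
    unfolding ev_sum[OF i] using i y by (intro sum.cong) (auto simp: ev_ev_inv)
  then show ?thesis
    using i by simp
qed

lemma component_mat_carrier:
  "A \<in> carrier_mat m n \<Longrightarrow> component_mat (c i) (\<beta> i) A \<in> carrier_mat m n"
  by (simp add: component_mat_def)

lemma component_mat_index:
  assumes "i \<in> {1..t}" "A \<in> carrier_mat m n" "r < m" "k < n"
  shows "component_mat (c i) (\<beta> i) A $$ (r, k) = ev (\<beta> i) (A $$ (r, k))"
  using assms by (simp add: component_mat_def ev_mult ev_c)

lemma mult_mat_vec_ev_iff:
  fixes A :: "'l cyc mat"
  assumes A: "A \<in> carrier_mat m n" and v: "v \<in> carrier_vec n" and w: "w \<in> carrier_vec m"
  shows "w = A *\<^sub>v v \<longleftrightarrow> (\<forall>i\<in>{1..t}. \<forall>r<m.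
    ev (\<beta> i) (w $ r) = (\<Sum>k<n. ev (\<beta> i) (A $$ (r, k)) * ev (\<beta> i) (v $ k)))"
proof -
  have index: "(A *\<^sub>v v) $ r = (\<Sum>k<n. A $$ (r, k) * v $ k)" if "r < m" for r
    using that A v by (auto simp: scalar_prod_def atLeast0LessThan intro!: sum.cong)
  then have ev_index: "ev (\<beta> i) ((A *\<^sub>v v) $ r) = (\<Sum>k<n. ev (\<beta> i) (A $$ (r, k)) * ev (\<beta> i) (v $ k))"
    if "i \<in> {1..t}" "r < m" for i r
    using that by (simp add: ev_sum ev_mult)
  show ?thesis
  proof
    assume R: "\<forall>i\<in>{1..t}. \<forall>r<m.
      ev (\<beta> i) (w $ r) = (\<Sum>k<n. ev (\<beta> i) (A $$ (r, k)) * ev (\<beta> i) (v $ k))"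
    show "w = A *\<^sub>v v"
    proof (rule eq_vecI)
      fix r assume "r < dim_vec (A *\<^sub>v v)"
      then have "r < m"
        using A by simp
      then show "w $ r = (A *\<^sub>v v) $ r"
        using R ev_index by (intro ev_eqI) auto
    qed (use A w in simp)
  qed (simp add: ev_index)
qed

end

text \<open>The results concern the kernel of \<open>A\<close> and the image of its transpose. Two
  instances, for the given matrix and for its transpose, therefore cover all kernels and images in
  question.\<close>

locale crt_code = crt_components t b \<beta> c
  for t b and \<beta> :: "nat \<Rightarrow> 'k::field" and c :: "nat \<Rightarrow> 'l::finite cyc" +
  fixes A :: "'l cyc mat" and m n :: nat and I :: "nat \<Rightarrow> nat set" and g :: "nat \<Rightarrow> nat \<Rightarrow> 'k vec"
  assumes A: "A \<in> carrier_mat m n"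
    and I: "\<And>i. i \<in> {1..t} \<Longrightarrow> I i \<subseteq> {0..<n}"
    and generator: "\<And>i. i \<in> {1..t} \<Longrightarrow> systematic_generator (Fq (\<beta> i)) n
          (ker_over (Fq (\<beta> i)) (component_mat (c i) (\<beta> i) A)) (I i) (g i)"
    and finite_Fq: "\<And>i. i \<in> {1..t} \<Longrightarrow> finite (Fq (\<beta> i))"
begin

lemma finite_I: "i \<in> {1..t} \<Longrightarrow> finite (I i)"
  using I finite_subset by blast

lemma ker_component_iff:
  assumes i: "i \<in> {1..t}"
  shows "v \<in> ker_over (Fq (\<beta> i)) (component_mat (c i) (\<beta> i) A) \<longleftrightarrow> v \<in> carrier_vec n \<and>
    (\<forall>k<n. v $ k \<in> Fq (\<beta> i)) \<and> (\<forall>r<m. (\<Sum>k<n. ev (\<beta> i) (A $$ (r, k)) * v $ k) = 0)"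
  unfolding ker_over_iff[OF component_mat_carrier[OF A]]
  using component_mat_index[OF i A] by auto

lemma ker_component_iff_systematic:
  assumes "i \<in> {1..t}" "v \<in> carrier_vec n" "\<forall>k<n. v $ k \<in> Fq (\<beta> i)"
  shows "v \<in> ker_over (Fq (\<beta> i)) (component_mat (c i) (\<beta> i) A) \<longleftrightarrow>
    (\<forall>k<n. v $ k = (\<Sum>j\<in>I i. v $ j * g i j $ k))"
  using ker_over_iff_systematic[OF closed_scalars_Fq[OF char2] component_mat_carrier[OF A] I generator]
    assms by blast

lemma g_in_ker:
  assumes "i \<in> {1..t}" "j \<in> I i"
  shows "g i j \<in> ker_over (Fq (\<beta> i)) (component_mat (c i) (\<beta> i) A)"
  using systematic_generator_mem[OF closed_scalars_Fq[OF char2] component_mat_carrier[OF A] I generator]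
    assms by blast

lemma g_in_Fq: "i \<in> {1..t} \<Longrightarrow> j \<in> I i \<Longrightarrow> k < n \<Longrightarrow> g i j $ k \<in> Fq (\<beta> i)"
  using g_in_ker ker_component_iff by blast

lemma g_systematic:
  "i \<in> {1..t} \<Longrightarrow> j \<in> I i \<Longrightarrow> j' \<in> I i \<Longrightarrow> g i j $ j' = (if j = j' then 1 else 0)"
  using generator[of i] unfolding systematic_generator_def by blast

lemma mat_kernel_eq:
  "mat_kernel A = {v \<in> carrier_vec n. \<forall>i\<in>{1..t}. \<forall>k<n.
     ev (\<beta> i) (v $ k) = (\<Sum>j\<in>I i. ev (\<beta> i) (v $ j) * g i j $ k)}"
proof -
  have "v \<in> mat_kernel A \<longleftrightarrow> (\<forall>i\<in>{1..t}. \<forall>k<n.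
      ev (\<beta> i) (v $ k) = (\<Sum>j\<in>I i. ev (\<beta> i) (v $ j) * g i j $ k))"
    if v: "v \<in> carrier_vec n" for v
  proof -
    have "v \<in> mat_kernel A \<longleftrightarrow> 0\<^sub>v m = A *\<^sub>v v"
      using A v by (auto simp: mat_kernel_def)
    also have "\<dots> \<longleftrightarrow> (\<forall>i\<in>{1..t}. \<forall>r<m. (\<Sum>k<n. ev (\<beta> i) (A $$ (r, k)) * ev (\<beta> i) (v $ k)) = 0)"
      unfolding mult_mat_vec_ev_iff[OF A v zero_carrier_vec] by (auto simp: ev_0)
    also have "\<dots> \<longleftrightarrow> (\<forall>i\<in>{1..t}. map_vec (ev (\<beta> i)) v \<in>
        ker_over (Fq (\<beta> i)) (component_mat (c i) (\<beta> i) A))"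
      using v by (intro ball_cong refl) (auto simp: ker_component_iff ev_in_Fq)
    also have "\<dots> \<longleftrightarrow> (\<forall>i\<in>{1..t}. \<forall>k<n.
        ev (\<beta> i) (v $ k) = (\<Sum>j\<in>I i. ev (\<beta> i) (v $ j) * g i j $ k))"
    proof (intro ball_cong refl)
      fix i assume i: "i \<in> {1..t}"
      have sub: "j < n" if "j \<in> I i" for j
        using that I[OF i] by auto
      have "map_vec (ev (\<beta> i)) v \<in> ker_over (Fq (\<beta> i)) (component_mat (c i) (\<beta> i) A) \<longleftrightarrow>
          (\<forall>k<n. map_vec (ev (\<beta> i)) v $ k = (\<Sum>j\<in>I i. map_vec (ev (\<beta> i)) v $ j * g i j $ k))"
        using v by (intro ker_component_iff_systematic[OF i]) (auto simp: ev_in_Fq[OF i])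
      also have "\<dots> \<longleftrightarrow> (\<forall>k<n. ev (\<beta> i) (v $ k) = (\<Sum>j\<in>I i. ev (\<beta> i) (v $ j) * g i j $ k))"
        using v sub by simp
      finally show "map_vec (ev (\<beta> i)) v \<in> ker_over (Fq (\<beta> i)) (component_mat (c i) (\<beta> i) A) \<longleftrightarrow>
          (\<forall>k<n. ev (\<beta> i) (v $ k) = (\<Sum>j\<in>I i. ev (\<beta> i) (v $ j) * g i j $ k))" .
    qed
    finally show ?thesis .
  qed
  moreover have "mat_kernel A \<subseteq> carrier_vec n"
    using A by (auto simp: mat_kernel_def)
  ultimately show ?thesis
    by blast
qed

text \<open>In each component the image of the transpose is the annihilator of the kernel, and it is
  enough to test the systematic generators because they span the kernel.\<close>

lemma mat_image_transpose_iff: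
  assumes v: "v \<in> carrier_vec n"
  shows "v \<in> mat_image (transpose_mat A) \<longleftrightarrow>
    (\<forall>i\<in>{1..t}. \<forall>j\<in>I i. (\<Sum>k<n. g i j $ k * ev (\<beta> i) (v $ k)) = 0)"
proof
  have At: "transpose_mat A \<in> carrier_mat n m"
    using A by simp
  have At_index: "transpose_mat A $$ (k, r) = A $$ (r, k)" if "k < n" "r < m" for k r
    using A that by simp
  note mult_iff = mult_mat_vec_ev_iff[OF At _ v]
  {
    assume "v \<in> mat_image (transpose_mat A)"
    then obtain x where x: "x \<in> carrier_vec m" "v = transpose_mat A *\<^sub>v x"
      using A by (auto simp: mat_image_iff)
    have ev_v: "ev (\<beta> i) (v $ k) = (\<Sum>r<m. ev (\<beta> i) (A $$ (r, k)) * ev (\<beta> i) (x $ r))"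
      if "i \<in> {1..t}" "k < n" for i k
      using iffD1[OF mult_iff[OF x(1)] x(2)] that At_index by simp
    show "\<forall>i\<in>{1..t}. \<forall>j\<in>I i. (\<Sum>k<n. g i j $ k * ev (\<beta> i) (v $ k)) = 0"
    proof (intro ballI)
      fix i j assume i: "i \<in> {1..t}" and j: "j \<in> I i"
      have "(\<Sum>k<n. g i j $ k * ev (\<beta> i) (v $ k))
          = (\<Sum>k<n. \<Sum>r<m. ev (\<beta> i) (x $ r) * (ev (\<beta> i) (A $$ (r, k)) * g i j $ k))"
        using i by (intro sum.cong) (auto simp: ev_v sum_distrib_left ac_simps)
      also have "\<dots> = (\<Sum>r<m. ev (\<beta> i) (x $ r) * (\<Sum>k<n. ev (\<beta> i) (A $$ (r, k)) * g i j $ k))"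
        by (subst sum.swap) (simp add: sum_distrib_left)
      also have "\<dots> = 0"
        using g_in_ker[OF i j] i by (simp add: ker_component_iff)
      finally show "(\<Sum>k<n. g i j $ k * ev (\<beta> i) (v $ k)) = 0" .
    qed
  next
    assume orth: "\<forall>i\<in>{1..t}. \<forall>j\<in>I i. (\<Sum>k<n. g i j $ k * ev (\<beta> i) (v $ k)) = 0"
    have "\<exists>x. (\<forall>r<m. x r \<in> Fq (\<beta> i)) \<and>
        (\<forall>k<n. ev (\<beta> i) (v $ k) = (\<Sum>r<m. x r * ev (\<beta> i) (A $$ (r, k))))" if i: "i \<in> {1..t}" for i
    proof (rule ccontr)
      assume "\<not> ?thesis"
      \<comment> \<open>A component outside the row space would be separated from the rows by some
        \<open>y\<close>. This \<open>y\<close> is a kernel vector, hence a combination of the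
        generators, so its pairing with the component is 0 and not 1.\<close>
      then obtain y where y: "\<forall>k<n. y k \<in> Fq (\<beta> i)"
        "\<forall>r<m. (\<Sum>k<n. y k * ev (\<beta> i) (A $$ (r, k))) = 0"
        "(\<Sum>k<n. y k * ev (\<beta> i) (v $ k)) = 1"
        using separating_functional[OF closed_scalars_Fq[OF char2] finite_Fq[OF i], of m n
            "\<lambda>r k. ev (\<beta> i) (A $$ (r, k))" "\<lambda>k. ev (\<beta> i) (v $ k)"] ev_in_Fq[OF i]
        by blast
      then have "vec n y \<in> ker_over (Fq (\<beta> i)) (component_mat (c i) (\<beta> i) A)"
        by (simp add: ker_component_iff[OF i] mult.commute)
      then have "\<forall>k<n. vec n y $ k = (\<Sum>j\<in>I i. vec n y $ j * g i j $ k)"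
        using y(1) by (subst (asm) ker_component_iff_systematic[OF i]) auto
      then have "(\<Sum>k<n. y k * ev (\<beta> i) (v $ k))
          = (\<Sum>k<n. \<Sum>j\<in>I i. vec n y $ j * (g i j $ k * ev (\<beta> i) (v $ k)))"
        by (intro sum.cong) (auto simp: sum_distrib_right mult.assoc)
      also have "\<dots> = (\<Sum>j\<in>I i. vec n y $ j * (\<Sum>k<n. g i j $ k * ev (\<beta> i) (v $ k)))"
        by (subst sum.swap) (simp add: sum_distrib_left)
      also have "\<dots> = 0"
        using orth i by simp
      finally show False
        using y(3) by simp
    qed
    then obtain x where x: "\<And>i r. i \<in> {1..t} \<Longrightarrow> r < m \<Longrightarrow> x i r \<in> Fq (\<beta> i)"
      "\<And>i k. i \<in> {1..t} \<Longrightarrow> k < n \<Longrightarrow>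
         ev (\<beta> i) (v $ k) = (\<Sum>r<m. x i r * ev (\<beta> i) (A $$ (r, k)))"
      by metis
    \<comment> \<open>The preimages found in the separate components are glued coordinatewise into
      one vector over \<open>R\<close>.\<close>
    let ?x = "vec m (\<lambda>r. \<Sum>i\<in>{1..t}. ev_inv (c i) (\<beta> i) (x i r))"
    have "ev (\<beta> i) (v $ k) = (\<Sum>r<m. ev (\<beta> i) (transpose_mat A $$ (k, r)) * ev (\<beta> i) (?x $ r))"
      if i: "i \<in> {1..t}" and k: "k < n" for i k
      unfolding x(2)[OF that]
    proof (rule sum.cong)
      fix r assume "r \<in> {..<m}"
      then have "ev (\<beta> i) (?x $ r) = x i r" "transpose_mat A $$ (k, r) = A $$ (r, k)"
        using ev_glue[OF i, of "\<lambda>i. x i r"] x(1) At_index k by auto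
      then show "x i r * ev (\<beta> i) (A $$ (r, k)) = ev (\<beta> i) (transpose_mat A $$ (k, r)) * ev (\<beta> i) (?x $ r)"
        by (simp only: mult.commute)
    qed simp
    then have "v = transpose_mat A *\<^sub>v ?x"
      by (subst mult_iff) auto
    then show "v \<in> mat_image (transpose_mat A)"
      using A by (auto simp: mat_image_iff intro!: bexI[of _ ?x])
  }
qed

text \<open>The shape is that of \<open>lin_combs_components\<close>, with unit vectors in place of the systematic
  generators; see \<open>coord_space_iff\<close> for the meaning.\<close>

definition coord_space :: "'l cyc vec set" where
  "coord_space = {v \<in> carrier_vec n. \<forall>i\<in>{1..t}. \<forall>k<n.
     ev (\<beta> i) (v $ k) = (\<Sum>j\<in>I i. ev (\<beta> i) (v $ j) * (if j = k then 1 else 0))}"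

lemma coord_space_iff:
  "v \<in> coord_space \<longleftrightarrow>
     v \<in> carrier_vec n \<and> (\<forall>i\<in>{1..t}. \<forall>k<n. k \<notin> I i \<longrightarrow> ev (\<beta> i) (v $ k) = 0)"
proof -
  have "(\<Sum>j\<in>I i. ev (\<beta> i) (v $ j) * (if j = k then 1 else 0)) = (if k \<in> I i then ev (\<beta> i) (v $ k) else 0)"
    if "i \<in> {1..t}" for i k
    using finite_I[OF that] by (simp add: if_distrib[of "\<lambda>x. _ * x"] cong: if_cong)
  then show ?thesis
    unfolding coord_space_def by fastforce
qed

text \<open>The supports meet in one point: \<open>w\<close> vanishes outside \<open>I i\<close> at
  this component, and on \<open>I i\<close> the generator is the unit vector at \<open>j\<close>. So
  pairing with generators recovers the coordinates, which is why the information set yields a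
  complement of the annihilator.\<close>

lemma pairing_coord_space:
  assumes w: "w \<in> coord_space" and i: "i \<in> {1..t}" and j: "j \<in> I i"
  shows "(\<Sum>k<n. g i j $ k * ev (\<beta> i) (w $ k)) = ev (\<beta> i) (w $ j)"
proof -
  have "j < n"
    using I i j by force
  have "(\<Sum>k<n. g i j $ k * ev (\<beta> i) (w $ k)) = (\<Sum>k<n. if k = j then ev (\<beta> i) (w $ k) else 0)"
  proof (rule sum.cong)
    fix k assume "k \<in> {..<n}"
    then show "g i j $ k * ev (\<beta> i) (w $ k) = (if k = j then ev (\<beta> i) (w $ k) else 0)"
      using w i j g_systematic[OF i j, of k] by (cases "k \<in> I i") (auto simp: coord_space_iff)
  qed simp
  then show ?thesis
    using \<open>j < n\<close> by simp
qed

lemma coord_space_inter_image: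
  assumes v: "v \<in> coord_space" "v \<in> mat_image (transpose_mat A)"
  shows "v = 0\<^sub>v n"
proof (rule eq_vecI)
  have vn: "v \<in> carrier_vec n"
    using v by (simp add: coord_space_def)
  then show "dim_vec v = dim_vec (0\<^sub>v n)"
    by simp
  fix k assume "k < dim_vec (0\<^sub>v n :: 'l cyc vec)"
  then have k: "k < n"
    by simp
  have "v $ k = 0"
  proof (rule ev_eqI)
    fix i assume i: "i \<in> {1..t}"
    show "ev (\<beta> i) (v $ k) = ev (\<beta> i) (0 :: 'l cyc)"
    proof (cases "k \<in> I i")
      case True
      then show ?thesis
        using pairing_coord_space[OF v(1) i True] v(2) mat_image_transpose_iff[OF vn] i by (simp add: ev_0)
    qed (use v(1) i k in \<open>auto simp: coord_space_iff ev_0\<close>)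
  qed
  then show "v $ k = 0\<^sub>v n $ k"
    using k by simp
qed

lemma coord_space_plus_image:
  assumes v: "v \<in> carrier_vec n"
  shows "\<exists>w\<in>coord_space. v - w \<in> mat_image (transpose_mat A)"
proof -
  \<comment> \<open>The coordinates of \<open>w\<close> on the information set are forced: they must
    equal the pairings of \<open>v\<close> with the generators, so that the difference is orthogonal
    to all of them.\<close>
  let ?y = "\<lambda>k i. if k \<in> I i then \<Sum>k'<n. g i k $ k' * ev (\<beta> i) (v $ k') else 0"
  let ?w = "vec n (\<lambda>k. \<Sum>i\<in>{1..t}. ev_inv (c i) (\<beta> i) (?y k i))"
  have "?y k i \<in> Fq (\<beta> i)" if i: "i \<in> {1..t}" for i k
    using closed_scalars_Fq[OF char2, of "\<beta> i"] g_in_Fq[OF i] ev_in_Fq[OF i]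
    by (auto intro!: sum_mem_closed_scalars simp: closed_scalars_def)
  then have ev_w: "ev (\<beta> i) (?w $ k) = ?y k i" if "i \<in> {1..t}" "k < n" for i k
    using that ev_glue[of i "?y k"] by simp
  have w: "?w \<in> coord_space"
    unfolding coord_space_iff by (auto simp only: ev_w vec_carrier if_False)
  have "v - ?w \<in> mat_image (transpose_mat A)"
  proof (subst mat_image_transpose_iff, use v in simp, intro ballI)
    fix i j assume i: "i \<in> {1..t}" and j: "j \<in> I i"
    have "j < n"
      using I i j by force
    have "(\<Sum>k<n. g i j $ k * ev (\<beta> i) ((v - ?w) $ k))
        = (\<Sum>k<n. g i j $ k * ev (\<beta> i) (v $ k)) - (\<Sum>k<n. g i j $ k * ev (\<beta> i) (?w $ k))"
      using v i by (simp add: ev_minus right_diff_distrib sum_subtractf)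
    also have "\<dots> = 0"
      using pairing_coord_space[OF w i j] ev_w[OF i \<open>j < n\<close>] j by simp
    finally show "(\<Sum>k<n. g i j $ k * ev (\<beta> i) ((v - ?w) $ k)) = 0" .
  qed
  with w show ?thesis
    by blast
qed

end

section \<open>Conjugation\<close>

lemma cyc_conj_of_poly:
  "cyc_conj (cyc_of_poly p :: 'l::finite cyc) = cyc_of_poly (pcompose p (monom 1 (CARD('l) - 1)))"
  by (simp add: cyc_of_poly_def cyc_conj.abs_eq)

lemma cyc_conj_add: "cyc_conj (f + g) = cyc_conj f + cyc_conj g"
proof -
  have "cyc_conj (cyc_of_poly p + cyc_of_poly q) = cyc_conj (cyc_of_poly p :: 'a cyc) + cyc_conj (cyc_of_poly q)"
    for p q
    by (simp add: cyc_conj_of_poly pcompose_add flip: cyc_of_poly_add)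
  then show ?thesis
    by (metis cyc_of_poly_rep)
qed

lemma cyc_conj_mult: "cyc_conj (f * g) = cyc_conj f * cyc_conj g"
proof -
  have "cyc_conj (cyc_of_poly p * cyc_of_poly q) = cyc_conj (cyc_of_poly p :: 'a cyc) * cyc_conj (cyc_of_poly q)"
    for p q
    by (simp add: cyc_conj_of_poly pcompose_mult flip: cyc_of_poly_mult)
  then show ?thesis
    by (metis cyc_of_poly_rep)
qed

lemma cyc_conj_0: "cyc_conj 0 = 0"
  and cyc_conj_1: "cyc_conj 1 = 1"
  by (simp_all add: cyc_conj_of_poly pcompose_1 flip: cyc_of_poly_0 cyc_of_poly_1)

lemma cyc_conj_sum: "cyc_conj (\<Sum>p\<in>P. f p) = (\<Sum>p\<in>P. cyc_conj (f p))"
  by (induction P rule: infinite_finite_induct) (auto simp: cyc_conj_0 cyc_conj_add)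

lemma cyc_conj_diff: "cyc_conj (f - g) = cyc_conj f - cyc_conj g"
  using cyc_conj_add[of "f - g" g] by simp

lemma cyc_conj_power: "cyc_conj (f ^ n) = cyc_conj f ^ n"
  by (induction n) (auto simp: cyc_conj_1 cyc_conj_mult)

text \<open>The product is \<open>x\<close> to the power \<open>l\<close>, which is 1 because the
  modulus is also that power minus 1 over \<open>bit\<close>.\<close>

lemma cyc_x_conj: "cyc_x * cyc_conj cyc_x = (1 :: 'l::finite cyc)"
proof -
  have "pcompose (monom 1 1) r = r" for r :: "bit poly"
    by (simp add: monom_Suc pcompose_pCons pcompose_1)
  then have "cyc_x * cyc_conj cyc_x = (cyc_of_poly (monom 1 (Suc (CARD('l) - 1))) :: 'l cyc)"
    by (simp add: cyc_x_def cyc_conj_of_poly mult_monom flip: cyc_of_poly_mult)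
  also have "\<dots> = cyc_of_poly (monom 1 CARD('l))"
    by simp
  also have "\<dots> = cyc_of_poly 1"
  proof -
    have "monom 1 CARD('l) - 1 = cyc_modulus TYPE('l)"
      unfolding cyc_modulus_def by (rule poly_eqI) simp
    then show ?thesis
      by (simp add: cyc_of_poly_eq_iff cong_iff_dvd_diff)
  qed
  finally show ?thesis
    by (simp add: cyc_of_poly_1)
qed

text \<open>Conjugation sends \<open>x\<close> to its inverse and fixes constants, so its square
  fixes \<open>x\<close> by uniqueness of inverses and then every polynomial in
  \<open>x\<close>.\<close>

lemma cyc_conj_conj: "cyc_conj (cyc_conj f) = (f :: 'l::finite cyc)"
proof -
  let ?x = "cyc_x :: 'l cyc"
  have "cyc_conj ?x * cyc_conj (cyc_conj ?x) = 1"
    using arg_cong[OF cyc_x_conj, of cyc_conj] by (simp add: cyc_conj_mult cyc_conj_1)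
  then have x: "cyc_conj (cyc_conj ?x) = ?x"
    using cyc_x_conj by (metis mult.assoc mult.left_neutral mult.right_neutral)
  have const: "cyc_conj (cyc_of_poly [:a:]) = (cyc_of_poly [:a:] :: 'l cyc)" for a
    by (simp add: cyc_conj_of_poly)
  have "cyc_conj (cyc_conj (cyc_of_poly p)) = (cyc_of_poly p :: 'l cyc)" for p
  proof (induction p)
    case (pCons a p)
    have "pCons a p = [:a:] + monom 1 1 * p"
      by (simp add: monom_Suc)
    then have "cyc_of_poly (pCons a p) = cyc_of_poly [:a:] + ?x * cyc_of_poly p"
      by (simp only: cyc_of_poly_add cyc_of_poly_mult cyc_x_def)
    then show ?case
      using pCons by (simp add: cyc_conj_add cyc_conj_mult const x)
  qed (simp add: cyc_of_poly_0 cyc_conj_0)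
  then show ?thesis
    by (metis cyc_of_poly_rep)
qed

lemma map_vec_cyc_conj_conj: "map_vec cyc_conj (map_vec cyc_conj v) = v"
  by (intro eq_vecI) (auto simp: cyc_conj_conj)

lemma map_vec_cyc_conj_0: "map_vec cyc_conj (0\<^sub>v n) = 0\<^sub>v n"
  by (intro eq_vecI) (auto simp: cyc_conj_0)

lemma cyc_conj_F2: "x \<in> F2 \<Longrightarrow> cyc_conj x \<in> F2"
  by (auto simp: F2_def cyc_conj_0 cyc_conj_1)

text \<open>Conjugation is semilinear: it also acts on the coefficients, hence the closure condition
  on \<open>S\<close>. Being an involution, it gives both directions from one.\<close>

lemma lin_combs_cyc_conj_iff:
  assumes S: "\<And>x. x \<in> S \<Longrightarrow> cyc_conj x \<in> S"
  shows "v \<in> lin_combs S n P (\<lambda>p k. cyc_conj (f p k)) \<longleftrightarrow> map_vec cyc_conj v \<in> lin_combs S n P f"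
proof -
  have *: "map_vec cyc_conj v \<in> lin_combs S n P (\<lambda>p k. cyc_conj (f p k))"
    if v_in: "v \<in> lin_combs S n P f" for v f
  proof -
    obtain a where v: "v \<in> carrier_vec n" "\<forall>p\<in>P. a p \<in> S" "\<forall>k<n. v $ k = (\<Sum>p\<in>P. a p * f p k)"
      using v_in by (auto simp: lin_combs_iff)
    then show ?thesis
      using S by (intro lin_combsI[where a = "\<lambda>p. cyc_conj (a p)"])
        (auto simp: cyc_conj_sum cyc_conj_mult)
  qed
  from *[of "map_vec cyc_conj v" f] *[of v "\<lambda>p k. cyc_conj (f p k)"] show ?thesis
    by (auto simp: cyc_conj_conj map_vec_cyc_conj_conj)
qed

section \<open>Conjugation exchanges the adjoint with the transpose\<close>

lemma adjoint_mat_carrier: "A \<in> carrier_mat m n \<Longrightarrow> adjoint_mat A \<in> carrier_mat n m"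
  by (simp add: adjoint_mat_def)

lemma map_vec_cyc_conj_adjoint_mult:
  assumes A: "A \<in> carrier_mat m n" and v: "v \<in> carrier_vec m"
  shows "map_vec cyc_conj (adjoint_mat A *\<^sub>v v) = transpose_mat A *\<^sub>v map_vec cyc_conj v"
proof (rule eq_vecI)
  fix k assume "k < dim_vec (transpose_mat A *\<^sub>v map_vec cyc_conj v)"
  then have k: "k < n"
    using A by simp
  have "(adjoint_mat A *\<^sub>v v) $ k = (\<Sum>r<m. cyc_conj (A $$ (r, k)) * v $ r)"
    using A v k by (auto simp: adjoint_mat_def scalar_prod_def atLeast0LessThan intro!: sum.cong)
  moreover have "(transpose_mat A *\<^sub>v map_vec cyc_conj v) $ k = (\<Sum>r<m. A $$ (r, k) * cyc_conj (v $ r))"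
    using A v k by (auto simp: scalar_prod_def atLeast0LessThan intro!: sum.cong)
  ultimately show "map_vec cyc_conj (adjoint_mat A *\<^sub>v v) $ k
      = (transpose_mat A *\<^sub>v map_vec cyc_conj v) $ k"
    using A k by (simp add: adjoint_mat_def cyc_conj_sum cyc_conj_mult cyc_conj_conj)
qed (use A in \<open>simp add: adjoint_mat_def\<close>)

lemma mat_kernel_adjoint_iff:
  assumes A: "A \<in> carrier_mat m n"
  shows "v \<in> mat_kernel (adjoint_mat A) \<longleftrightarrow> map_vec cyc_conj v \<in> mat_kernel (transpose_mat A)"
proof (cases "v \<in> carrier_vec m")
  case True
  then have "map_vec cyc_conj v \<in> mat_kernel (transpose_mat A) \<longleftrightarrow>
      map_vec cyc_conj (adjoint_mat A *\<^sub>v v) = 0\<^sub>v n"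
    using A by (simp add: mat_kernel_def map_vec_cyc_conj_adjoint_mult)
  also have "\<dots> \<longleftrightarrow> adjoint_mat A *\<^sub>v v = 0\<^sub>v n"
    using map_vec_cyc_conj_0 map_vec_cyc_conj_conj by metis
  finally show ?thesis
    using A True adjoint_mat_carrier[OF A] by (simp add: mat_kernel_def)
next
  case False
  then show ?thesis
    using A adjoint_mat_carrier[OF A] by (auto simp: mat_kernel_def)
qed

lemma mat_image_adjoint_iff:
  assumes A: "A \<in> carrier_mat m n"
  shows "v \<in> mat_image (adjoint_mat A) \<longleftrightarrow> map_vec cyc_conj v \<in> mat_image (transpose_mat A)"
proof
  assume "v \<in> mat_image (adjoint_mat A)"
  then obtain x where x: "x \<in> carrier_vec m" "v = adjoint_mat A *\<^sub>v x"
    using adjoint_mat_carrier[OF A] by (auto simp: mat_image_iff)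
  then show "map_vec cyc_conj v \<in> mat_image (transpose_mat A)"
    using A unfolding mat_image_iff
    by (intro bexI[of _ "map_vec cyc_conj x"]) (simp_all add: map_vec_cyc_conj_adjoint_mult)
next
  assume "map_vec cyc_conj v \<in> mat_image (transpose_mat A)"
  then obtain x where x: "x \<in> carrier_vec m" "map_vec cyc_conj v = transpose_mat A *\<^sub>v x"
    using A by (auto simp: mat_image_iff)
  then have "map_vec cyc_conj v = map_vec cyc_conj (adjoint_mat A *\<^sub>v map_vec cyc_conj x)"
    using A by (simp add: map_vec_cyc_conj_adjoint_mult map_vec_cyc_conj_conj)
  then have "v = adjoint_mat A *\<^sub>v map_vec cyc_conj x"
    by (metis map_vec_cyc_conj_conj)
  then show "v \<in> mat_image (adjoint_mat A)"
    using x(1) adjoint_mat_carrier[OF A] unfolding mat_image_iff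
    by (intro bexI[of _ "map_vec cyc_conj x"]) auto
qed

section \<open>Minimality by counting elements of spans over the two-element field\<close>

lemma card_row_span_F2:
  fixes M :: "'l::finite cyc mat"
  shows "finite (row_span F2 M)" "card (row_span F2 M) \<le> 2 ^ dim_row M"
proof -
  have "finite (F2 :: 'l cyc set)"
    by (simp add: F2_def)
  then show "finite (row_span F2 M)" "card (row_span F2 M) \<le> 2 ^ dim_row M"
    unfolding row_span_eq_rows[OF closed_scalars_F2 refl]
    using finite_lin_combs[of "F2 :: 'l cyc set" "{..<dim_row M}" "dim_col M"]
    by (simp_all add: card_F2)
qed

lemma fewest_rows_kerI:
  fixes G :: "'l::finite cyc mat"
  assumes "dim_col G = dim_col B" "row_span F2 G = mat_kernel B"
    and card: "card (row_span F2 G) = 2 ^ dim_row G"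
  shows "fewest_rows (\<lambda>M. generates_ker F2 M B) G"
proof -
  have "dim_row G \<le> dim_row M" if "row_span F2 M = mat_kernel B" for M
  proof -
    have "(2::nat) ^ dim_row G \<le> 2 ^ dim_row M"
      using card_row_span_F2(2)[of M] card assms(2) that by simp
    then show ?thesis
      by simp
  qed
  then show ?thesis
    using assms by (auto simp: fewest_rows_def generates_ker_def)
qed

text \<open>A competing matrix need only map onto the cokernel and may have a span meeting the image
  nontrivially; the size of its span still bounds the size of the cokernel from above.\<close>

lemma fewest_rows_cokerI:
  fixes E :: "'l::finite cyc mat"
  assumes "dim_col E = dim_row B" and iso: "row_span_iso_coker F2 E B"
    and card: "card (row_span F2 E) = 2 ^ dim_row E"
  shows "fewest_rows (\<lambda>M. generates_coker F2 M B) E"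
proof -
  have bij: "bij_betw (coker_map B) (row_span F2 E) (carrier (coker B))"
    using iso by (simp add: row_span_iso_coker_def)
  have "dim_row E \<le> dim_row M" if M: "coker_map B ` row_span F2 M = carrier (coker B)" for M
  proof -
    have "2 ^ dim_row E = card (coker_map B ` row_span F2 M)"
      using bij_betw_same_card[OF bij] card M by simp
    also have "\<dots> \<le> card (row_span F2 M)"
      by (rule card_image_le[OF card_row_span_F2(1)])
    also have "\<dots> \<le> 2 ^ dim_row M"
      by (rule card_row_span_F2(2))
    finally show ?thesis
      by simp
  qed
  then show ?thesis
    using assms(1) bij by (auto simp: fewest_rows_def generates_coker_def bij_betw_def)
qed

section \<open>Bases over the two-element field\<close>

context crt_components
begin

lemma module_of_bit: "Modules.module (\<lambda>(x::bit) (y::'k). of_bit x * y)"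
  by unfold_locales
    (auto simp: of_bit_add[OF char2] of_bit_mult[OF char2] two_eq_0[OF char2] algebra_simps)

text \<open>Translates bases with scalars in \<open>bit\<close> into expansions with coefficients in
  the copy \<open>F2\<close> inside \<open>R\<close>, the form used for row spans.\<close>

lemma
  assumes i: "i \<in> {1..t}" and basis: "F2_basis_family (Fq (\<beta> i)) {0..<d} f"
  shows F2_basis_family_span: "y \<in> Fq (\<beta> i) \<Longrightarrow>
      \<exists>a::nat \<Rightarrow> 'l cyc. (\<forall>q<d. a q \<in> F2) \<and> y = (\<Sum>q<d. ev (\<beta> i) (a q) * f q)"
    and F2_basis_family_indep: "\<forall>q<d. (a q :: 'l cyc) \<in> F2 \<and> a' q \<in> F2 \<Longrightarrow>
      (\<Sum>q<d. ev (\<beta> i) (a q) * f q) = (\<Sum>q<d. ev (\<beta> i) (a' q) * f q) \<Longrightarrow> \<forall>q<d. a q = a' q"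
proof -
  interpret M: Modules.module "\<lambda>(x::bit) (y::'k). of_bit x * y"
    by (rule module_of_bit)
  have inj: "inj_on f {0..<d}" and indep: "\<not> M.dependent (f ` {0..<d})"
    and span: "M.span (f ` {0..<d}) = Fq (\<beta> i)"
    using basis by (auto simp: F2_basis_family_def)
  have reindex: "(\<Sum>v\<in>f ` {0..<d}. of_bit (s v) * v) = (\<Sum>q<d. of_bit (s (f q)) * f q)" for s
    unfolding sum.reindex[OF inj] by (simp only: atLeast0LessThan o_def)
  show "\<exists>a::nat \<Rightarrow> 'l cyc. (\<forall>q<d. a q \<in> F2) \<and> y = (\<Sum>q<d. ev (\<beta> i) (a q) * f q)"
    if "y \<in> Fq (\<beta> i)"
  proof -
    obtain s where s: "y = (\<Sum>v\<in>f ` {0..<d}. of_bit (s v) * v)"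
      using \<open>y \<in> Fq (\<beta> i)\<close>
      unfolding span[symmetric] M.span_finite[OF finite_imageI[OF finite_atLeastLessThan]] by blast
    have "ev (\<beta> i) (of_bit (s (f q)) :: 'l cyc) = of_bit (s (f q))" for q
      using i by (simp add: ev_0 ev_1)
    moreover have "of_bit (s (f q)) \<in> (F2 :: 'l cyc set)" for q
      by (cases "s (f q)") (simp_all add: F2_def)
    ultimately show ?thesis
      unfolding s reindex by (intro exI[of _ "\<lambda>q. of_bit (s (f q))"]) simp
  qed
  show "\<forall>q<d. a q = a' q"
    if F2: "\<forall>q<d. (a q :: 'l cyc) \<in> F2 \<and> a' q \<in> F2"
      and eq: "(\<Sum>q<d. ev (\<beta> i) (a q) * f q) = (\<Sum>q<d. ev (\<beta> i) (a' q) * f q)"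
  proof (rule ccontr)
    assume "\<not> ?thesis"
    then obtain q0 where q0: "q0 < d" "a q0 \<noteq> a' q0"
      by blast
    \<comment> \<open>The difference of two 0/1 families: as -1 = 1 in the field, it is 1 exactly
      where they disagree, so two distinct expansions give a nontrivial relation.\<close>
    define s where "s v = (let q = inv_into {0..<d} f v in if a q = a' q then 0 else 1 :: bit)" for v
    have s_f: "s (f q) = (if a q = a' q then 0 else 1)" if "q < d" for q
      using inj that by (simp add: s_def inv_into_f_f)
    have "of_bit (s (f q)) = ev (\<beta> i) (a q) - ev (\<beta> i) (a' q)" if "q < d" for q
    proof -
      have "(-1 :: 'k) = 1"
        using two_eq_0[OF char2] by (simp add: neg_eq_iff_add_eq_0)
      then show ?thesis
        using F2 that i by (auto simp: s_f F2_def ev_0 ev_1)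
    qed
    then have "(\<Sum>v\<in>f ` {0..<d}. of_bit (s v) * v)
        = (\<Sum>q<d. ev (\<beta> i) (a q) * f q) - (\<Sum>q<d. ev (\<beta> i) (a' q) * f q)"
      unfolding reindex by (simp add: left_diff_distrib sum_subtractf)
    then have "(\<Sum>v\<in>f ` {0..<d}. of_bit (s v) * v) = 0"
      using eq by simp
    moreover have "s (f q0) \<noteq> 0" "f q0 \<in> f ` {0..<d}"
      using q0 s_f by auto
    ultimately have "M.dependent (f ` {0..<d})"
      unfolding M.dependent_finite[OF finite_imageI[OF finite_atLeastLessThan]] by blast
    then show False
      using indep by contradiction
  qed
qed

lemma finite_card_Fq:
  assumes i: "i \<in> {1..t}" and basis: "F2_basis_family (Fq (\<beta> i)) {0..<d} f"
  shows "finite (Fq (\<beta> i))" and "card (Fq (\<beta> i)) = 2 ^ d"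
proof -
  let ?\<Phi> = "\<lambda>a. \<Sum>q<d. ev (\<beta> i) (a q :: 'l cyc) * f q"
  let ?C = "{..<d} \<rightarrow>\<^sub>E (F2 :: 'l cyc set)"
  have basis_mem: "f q \<in> Fq (\<beta> i)" if "q < d" for q
  proof -
    interpret M: Modules.module "\<lambda>(x::bit) (y::'k). of_bit x * y"
      by (rule module_of_bit)
    show ?thesis
      using basis that M.span_superset[of "f ` {0..<d}"] by (auto simp: F2_basis_family_def)
  qed
  have "?\<Phi> ` ?C = Fq (\<beta> i)"
  proof
    show "?\<Phi> ` ?C \<subseteq> Fq (\<beta> i)"
      using closed_scalars_Fq[OF char2, of "\<beta> i"] basis_mem ev_in_Fq[OF i]
      by (auto intro!: sum_mem_closed_scalars simp: closed_scalars_def)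
    show "Fq (\<beta> i) \<subseteq> ?\<Phi> ` ?C"
    proof
      fix y assume "y \<in> Fq (\<beta> i)"
      then obtain a :: "nat \<Rightarrow> 'l cyc" where "\<forall>q<d. a q \<in> F2" "y = ?\<Phi> a"
        using F2_basis_family_span[OF i basis] by blast
      then show "y \<in> ?\<Phi> ` ?C"
        by (intro image_eqI[of _ _ "restrict a {..<d}"]) auto
    qed
  qed
  moreover have "inj_on ?\<Phi> ?C"
  proof (rule inj_onI)
    fix a a' assume C: "a \<in> ?C" "a' \<in> ?C" and "?\<Phi> a = ?\<Phi> a'"
    then have "\<forall>q<d. a q = a' q"
      by (intro F2_basis_family_indep[OF i basis]) auto
    then show "a = a'"
      using C by (auto intro: PiE_ext)
  qed
  moreover have "finite ?C" "card ?C = 2 ^ d"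
    by (auto intro!: finite_PiE simp: F2_def card_PiE numeral_2_eq_2)
  ultimately show "finite (Fq (\<beta> i))" "card (Fq (\<beta> i)) = 2 ^ d"
    using card_image[of ?\<Phi> ?C] finite_imageI[of ?C ?\<Phi>] by simp_all
qed

section \<open>Independence detected by coefficients of representatives\<close>

lemma coeff_cyc_rep_F2_combination:
  fixes d :: nat
  assumes a: "\<forall>q<d. a q \<in> F2"
    and h: "\<And>q. q < d \<Longrightarrow> coeff (cyc_rep (h q :: 'l cyc)) r = (if r' = q then 1 else 0)" and "r' < d"
  shows "coeff (cyc_rep (\<Sum>q<d. a q * h q)) r = of_bool (a r' \<noteq> 0)"
proof -
  have rep_sum: "coeff (cyc_rep (\<Sum>q\<in>Q. f q :: 'l cyc)) r = (\<Sum>q\<in>Q. coeff (cyc_rep (f q)) r)" for Q f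
    by (induction Q rule: infinite_finite_induct) (auto simp: cyc_rep_0 cyc_rep_add)
  have "coeff (cyc_rep (\<Sum>q<d. a q * h q)) r = (\<Sum>q<d. if q = r' then of_bool (a q \<noteq> 0) else 0)"
    unfolding rep_sum using a h by (intro sum.cong) (auto simp: F2_def cyc_rep_0)
  also have "\<dots> = of_bool (a r' \<noteq> 0)"
    using \<open>r' < d\<close> by (subst sum.delta) auto
  finally show ?thesis .
qed

text \<open>The coefficients at the positions \<open>r j\<close> are functionals dual to the family
  \<open>c i * h q\<close>, which gives independence. Spanning follows by counting: the
  \<open>2 ^ d\<close> combinations are distinct and lie in a field with \<open>2 ^ d\<close>
  elements, a number supplied by the basis \<open>f\<close>.\<close>

lemma
  assumes i: "i \<in> {1..t}" and basis: "F2_basis_family (Fq (\<beta> i)) {0..<d} f"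
    and h: "\<And>j q. j < d \<Longrightarrow> q < d \<Longrightarrow> coeff (cyc_rep (c i * h q)) (r j) = (if j = q then 1 else 0)"
  shows dual_basis_indep: "\<forall>q<d. a q \<in> F2 \<and> a' q \<in> F2 \<Longrightarrow>
      (\<Sum>q<d. ev (\<beta> i) (a q * h q)) = (\<Sum>q<d. ev (\<beta> i) (a' q * h q)) \<Longrightarrow> \<forall>q<d. a q = a' q"
    and dual_basis_span: "y \<in> Fq (\<beta> i) \<Longrightarrow>
      \<exists>a. (\<forall>q<d. a q \<in> F2) \<and> y = (\<Sum>q<d. ev (\<beta> i) (a q * h q))"
proof -
  show indep: "\<forall>q<d. a q = a' q"
    if F2: "\<forall>q<d. a q \<in> F2 \<and> a' q \<in> F2"
      and eq: "(\<Sum>q<d. ev (\<beta> i) (a q * h q)) = (\<Sum>q<d. ev (\<beta> i) (a' q * h q))" for a a'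
  proof (intro allI impI)
    fix j assume j: "j < d"
    \<comment> \<open>The coefficients belong to elements of \<open>R\<close>, while equality is
      known only at \<beta> i. The factor \<open>c i\<close> makes both sides vanish at all other
      roots, which lifts the equality to \<open>R\<close>.\<close>
    have "(\<Sum>q<d. a q * (c i * h q)) = (\<Sum>q<d. a' q * (c i * h q))"
    proof (rule ev_eqI)
      fix i' assume i': "i' \<in> {1..t}"
      have *: "ev (\<beta> i') (\<Sum>q<d. a q * (c i * h q)) = (if i' = i then \<Sum>q<d. ev (\<beta> i) (a q * h q) else 0)" for a
        using i i' by (auto simp: ev_sum ev_mult ev_c)
      show "ev (\<beta> i') (\<Sum>q<d. a q * (c i * h q)) = ev (\<beta> i') (\<Sum>q<d. a' q * (c i * h q))"
        unfolding * eq ..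
    qed
    moreover have "coeff (cyc_rep (\<Sum>q<d. a q * (c i * h q))) (r j) = of_bool (a j \<noteq> 0)"
      using F2 h[OF j] j by (intro coeff_cyc_rep_F2_combination) auto
    moreover have "coeff (cyc_rep (\<Sum>q<d. a' q * (c i * h q))) (r j) = of_bool (a' j \<noteq> 0)"
      using F2 h[OF j] j by (intro coeff_cyc_rep_F2_combination) auto
    ultimately have "of_bool (a j \<noteq> 0) = (of_bool (a' j \<noteq> 0) :: bit)"
      by simp
    then show "a j = a' j"
      using F2 j by (auto simp: F2_def)
  qed
  show "\<exists>a. (\<forall>q<d. a q \<in> F2) \<and> y = (\<Sum>q<d. ev (\<beta> i) (a q * h q))" if y: "y \<in> Fq (\<beta> i)"
  proof -
    let ?\<Phi> = "\<lambda>a. \<Sum>q<d. ev (\<beta> i) (a q * h q)"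
    let ?C = "{..<d} \<rightarrow>\<^sub>E (F2 :: 'l cyc set)"
    have "inj_on ?\<Phi> ?C"
    proof (rule inj_onI)
      fix a a' assume C: "a \<in> ?C" "a' \<in> ?C" and "?\<Phi> a = ?\<Phi> a'"
      then have "\<forall>q<d. a q = a' q"
        by (intro indep) auto
      then show "a = a'"
        using C by (auto intro: PiE_ext)
    qed
    moreover have "card ?C = 2 ^ d"
      by (simp add: F2_def card_PiE numeral_2_eq_2)
    ultimately have "card (?\<Phi> ` ?C) = card (Fq (\<beta> i))"
      using card_image[of ?\<Phi> ?C] finite_card_Fq(2)[OF i basis] by simp
    moreover have "?\<Phi> ` ?C \<subseteq> Fq (\<beta> i)"
      using closed_scalars_Fq[OF char2, of "\<beta> i"] ev_in_Fq[OF i] by (auto intro!: sum_mem_closed_scalars)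
    ultimately have "?\<Phi> ` ?C = Fq (\<beta> i)"
      using finite_card_Fq(1)[OF i basis] by (intro card_subset_eq)
    then obtain a where "a \<in> ?C" "y = ?\<Phi> a"
      using y by blast
    then show ?thesis
      by (intro exI[of _ a]) auto
  qed
qed

text \<open>The conjugate of \<open>cyc_x\<close> is its inverse. This links the powers of
  \<open>cyc_x\<close> in the rows generating the adjoint kernel to the basis of negative powers of
  \<beta> i.\<close>

lemma ev_conj_x_power:
  assumes i: "i \<in> {1..t}"
  shows "ev (\<beta> i) (cyc_conj (cyc_x :: 'l cyc) ^ n) = \<beta> i powi - int n"
proof -
  have "\<beta> i * ev (\<beta> i) (cyc_conj (cyc_x :: 'l cyc)) = 1"
    using arg_cong[OF cyc_x_conj, of "ev (\<beta> i) :: 'l cyc \<Rightarrow> 'k"] i by (simp add: ev_mult ev_x ev_1)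
  then have "ev (\<beta> i) (cyc_conj (cyc_x :: 'l cyc)) = inverse (\<beta> i)"
    by (metis inverse_unique)
  then show ?thesis
    using i by (simp add: ev_power power_int_minus power_inverse)
qed

end

section \<open>Spans of the lifted systematic generators and of the lifted unit vectors\<close>

context crt_code
begin

lemma lin_combs_systematic_generators:
  fixes d :: "nat \<Rightarrow> nat"
  assumes "\<And>i y. i \<in> {1..t} \<Longrightarrow> y \<in> Fq (\<beta> i) \<Longrightarrow>
    \<exists>a. (\<forall>q<d i. a q \<in> S) \<and> y = (\<Sum>q<d i. ev (\<beta> i) (a q * u i q))"
  shows "lin_combs S n (SIGMA i:{1..t}. I i \<times> {..<d i})
      (\<lambda>(i, j, q) k. u i q * ev_inv (c i) (\<beta> i) (g i j $ k)) = mat_kernel A"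
  unfolding mat_kernel_eq using assms
  by (intro lin_combs_components) (auto simp: I g_systematic ev_ev_inv g_in_Fq)

lemma card_lin_combs_systematic_generators:
  fixes d :: "nat \<Rightarrow> nat"
  assumes "\<And>i a a'. i \<in> {1..t} \<Longrightarrow> \<forall>q<d i. a q \<in> S \<and> a' q \<in> S \<Longrightarrow>
     (\<Sum>q<d i. ev (\<beta> i) (a q * u i q)) = (\<Sum>q<d i. ev (\<beta> i) (a' q * u i q)) \<Longrightarrow> \<forall>q<d i. a q = a' q"
  shows "card (lin_combs S n (SIGMA i:{1..t}. I i \<times> {..<d i})
      (\<lambda>(i, j, q) k. u i q * ev_inv (c i) (\<beta> i) (g i j $ k)))
    = card S ^ card (SIGMA i:{1..t}. I i \<times> {..<d i})"
  using assms by (intro card_lin_combs_components[where z = "\<lambda>i j k. g i j $ k"])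
    (auto simp: I g_systematic ev_ev_inv g_in_Fq)

lemma lin_combs_unit_vectors:
  fixes d :: "nat \<Rightarrow> nat"
  assumes "\<And>i y. i \<in> {1..t} \<Longrightarrow> y \<in> Fq (\<beta> i) \<Longrightarrow>
    \<exists>a. (\<forall>q<d i. a q \<in> S) \<and> y = (\<Sum>q<d i. ev (\<beta> i) (a q * u i q))"
  shows "lin_combs S n (SIGMA i:{1..t}. I i \<times> {..<d i})
      (\<lambda>(i, j, q) k. u i q * (if j = k then c i else 0)) = coord_space"
  unfolding coord_space_def using assms
  by (intro lin_combs_components) (auto simp: I ev_c ev_0)

lemma card_lin_combs_unit_vectors:
  fixes d :: "nat \<Rightarrow> nat"
  assumes "\<And>i a a'. i \<in> {1..t} \<Longrightarrow> \<forall>q<d i. a q \<in> S \<and> a' q \<in> S \<Longrightarrow>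
     (\<Sum>q<d i. ev (\<beta> i) (a q * u i q)) = (\<Sum>q<d i. ev (\<beta> i) (a' q * u i q)) \<Longrightarrow> \<forall>q<d i. a q = a' q"
  shows "card (lin_combs S n (SIGMA i:{1..t}. I i \<times> {..<d i})
      (\<lambda>(i, j, q) k. u i q * (if j = k then c i else 0)))
    = card S ^ card (SIGMA i:{1..t}. I i \<times> {..<d i})"
  using assms by (intro card_lin_combs_components[where z = "\<lambda>i j k. if j = k then 1 else 0"])
    (auto simp: I ev_c ev_0)

end

section \<open>The constructed matrices\<close>

lemma transpose_component_mat: "transpose_mat (component_mat c \<beta> A) = component_mat c \<beta> (transpose_mat A)"
  by (intro eq_matI) (auto simp: component_mat_def)

lemma set_component_list:
  fixes d :: "nat \<Rightarrow> nat"
  assumes fin: "\<And>i. i \<in> {1..t} \<Longrightarrow> finite (I i)"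
    and F: "\<And>i j q. i \<in> {1..t} \<Longrightarrow> j \<in> I i \<Longrightarrow> F i j q = G (i, j, q)"
  shows "set [F i j q. i \<leftarrow> [1..<t+1], j \<leftarrow> sorted_list_of_set (I i), q \<leftarrow> [0..<d i]]
    = G ` (SIGMA i:{1..t}. I i \<times> {..<d i})"
proof -
  have "set [F i j q. i \<leftarrow> [1..<t+1], j \<leftarrow> sorted_list_of_set (I i), q \<leftarrow> [0..<d i]]
      = (\<Union>i\<in>{1..t}. \<Union>j\<in>set (sorted_list_of_set (I i)). F i j ` {..<d i})"
    by (simp add: atLeastLessThanSuc_atLeastAtMost atLeast0LessThan del: upt_Suc)
  also have "\<dots> = (\<Union>i\<in>{1..t}. \<Union>j\<in>I i. (\<lambda>q. G (i, j, q)) ` {..<d i})"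
    using fin F by (intro SUP_cong refl) auto
  also have "\<dots> = G ` (SIGMA i:{1..t}. I i \<times> {..<d i})"
    by blast
  finally show ?thesis .
qed

text \<open>The number of rows is the length of a list, in which repetitions count; it has to agree
  with the size of the index family for the span to have \<open>2 ^ dim_row\<close>
  elements.\<close>

lemma
  assumes "\<And>i. i \<in> {1..t} \<Longrightarrow> finite (I i)"
  shows dim_row_mat_GA_adj:
      "dim_row (mat_GA_adj n t c \<beta> d I g m) = card (SIGMA i:{1..t}. I i \<times> {..<d i})"
    and dim_row_mat_EA:
      "dim_row (mat_EA n t c d I m h) = card (SIGMA i:{1..t}. I i \<times> {..<d i})"
proof -
  have "card (SIGMA i:{1..t}. I i \<times> {..<d i}) = (\<Sum>i\<in>{1..t}. card (I i) * d i)"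
    using assms by (subst card_SigmaI) (auto simp: card_cartesian_product intro: finite_cartesian_product)
  also have "\<dots> = (\<Sum>i\<leftarrow>[1..<t+1]. card (I i) * d i)"
    by (simp add: interv_sum_list_conv_sum_set_nat atLeastLessThanSuc_atLeastAtMost del: upt_Suc)
  finally have card: "card (SIGMA i:{1..t}. I i \<times> {..<d i}) = (\<Sum>i\<leftarrow>[1..<t+1]. card (I i) * d i)" .
  show "dim_row (mat_GA_adj n t c \<beta> d I g m) = card (SIGMA i:{1..t}. I i \<times> {..<d i})"
    unfolding card by (simp add: mat_GA_adj_def length_concat o_def sum_list_triv del: upt_Suc)
  show "dim_row (mat_EA n t c d I m h) = card (SIGMA i:{1..t}. I i \<times> {..<d i})"
    unfolding card by (simp add: mat_EA_def length_concat o_def sum_list_triv del: upt_Suc)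
qed

theorem theorem11:
  fixes A :: "'l::finite cyc mat" and mA nA t :: nat
    and b :: "nat \<Rightarrow> bit poly" and \<beta> :: "nat \<Rightarrow> 'k::field" and c :: "nat \<Rightarrow> 'l cyc"
    and d :: "nat \<Rightarrow> nat"
    and IA IA_adj :: "nat \<Rightarrow> nat set" and g1 g0 :: "nat \<Rightarrow> nat \<Rightarrow> 'k vec"
    and m :: "nat \<Rightarrow> nat \<Rightarrow> nat" and h :: "nat \<Rightarrow> nat \<Rightarrow> 'l cyc"
  assumes "odd CARD('l)" and "CHAR('k) = 2"
    and "A \<in> carrier_mat mA nA"
    and "monom 1 CARD('l) + 1 = (\<Prod>i\<in>{1..t}. b i)"
    and "\<And>i. i \<in> {1..t} \<Longrightarrow> irreducible (b i)"
    and "inj_on b {1..t}"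
    and "\<And>i. i \<in> {1..t} \<Longrightarrow> d i = degree (b i)"
    and "\<And>i. i \<in> {1..t} \<Longrightarrow> eval_poly2 (\<beta> i) (b i) = 0"
    and "\<And>i. i \<in> {1..t} \<Longrightarrow> c i * c i = c i"
    and "\<And>i. i \<in> {1..t} \<Longrightarrow> [cyc_rep (c i) = 1] (mod b i)"
    and "\<And>i j. i \<in> {1..t} \<Longrightarrow> j \<in> {1..t} \<Longrightarrow> j \<noteq> i \<Longrightarrow> [cyc_rep (c i) = 0] (mod b j)"
    and "\<And>i. i \<in> {1..t} \<Longrightarrow>
           information_set (Fq (\<beta> i)) nA
             (ker_over (Fq (\<beta> i)) (component_mat (c i) (\<beta> i) A)) (IA i)"
    and "\<And>i. i \<in> {1..t} \<Longrightarrow>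
           systematic_generator (Fq (\<beta> i)) nA
             (ker_over (Fq (\<beta> i)) (component_mat (c i) (\<beta> i) A)) (IA i) (g1 i)"
    and "\<And>i. i \<in> {1..t} \<Longrightarrow>
           information_set (Fq (\<beta> i)) mA
             (ker_over (Fq (\<beta> i)) (transpose_mat (component_mat (c i) (\<beta> i) A))) (IA_adj i)"
    and "\<And>i. i \<in> {1..t} \<Longrightarrow>
           systematic_generator (Fq (\<beta> i)) mA
             (ker_over (Fq (\<beta> i)) (transpose_mat (component_mat (c i) (\<beta> i) A))) (IA_adj i) (g0 i)"
    and "\<And>i k. i \<in> {1..t} \<Longrightarrow> k < d i \<Longrightarrow> m i k < CARD('l)"
    and "\<And>i. i \<in> {1..t} \<Longrightarrow> inj_on (m i) {0..<d i}"
    and "\<And>i. i \<in> {1..t} \<Longrightarrow>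
           F2_basis_family (Fq (\<beta> i)) {0..<d i} (\<lambda>k. \<beta> i powi - int (m i k))"
    and "\<And>i j k. i \<in> {1..t} \<Longrightarrow> j < d i \<Longrightarrow> k < d i \<Longrightarrow>
           coeff (cyc_rep (c i * h i (m i k))) (m i j) = (if j = k then 1 else 0)"
  shows "row_span UNIV (mat_GA nA t c \<beta> IA g1) = mat_kernel A
     \<and> row_span_iso_coker F2 (mat_EA mA t c d IA_adj m h) A
     \<and> row_span F2 (mat_GA_adj mA t c \<beta> d IA_adj g0 m) = mat_kernel (adjoint_mat A)
     \<and> row_span_iso_coker UNIV (mat_EA_adj nA t c IA) (adjoint_mat A)
     \<and> fewest_rows (\<lambda>M. generates_ker F2 M (adjoint_mat A)) (mat_GA_adj mA t c \<beta> d IA_adj g0 m)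
     \<and> fewest_rows (\<lambda>M. generates_coker F2 M A) (mat_EA mA t c d IA_adj m h)"
proof -
  let ?R = "UNIV :: 'l cyc set"
  interpret crt_components t b \<beta> c
    using assms(2,4,5,8,10,11) by unfold_locales (auto simp: cyc_modulus_def)
  have fin_Fq: "finite (Fq (\<beta> i))" if "i \<in> {1..t}" for i
    using assms(18)[OF that] that by (rule finite_card_Fq(1)[rotated])
  interpret K1: crt_code t b \<beta> c A mA nA IA g1
    using assms(3,12,13) fin_Fq by unfold_locales (auto simp: information_set_def)
  \<comment> \<open>Since transposing twice gives back \<open>A\<close>, this instance describes the
    kernel of the transpose and the image of \<open>A\<close>.\<close>
  interpret K0: crt_code t b \<beta> c "transpose_mat A" nA mA IA_adj g0
    using assms(3,14,15) fin_Fq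
    by unfold_locales (auto simp: information_set_def transpose_component_mat)
  \<comment> \<open>Over \<open>R\<close> every value at \<beta> i is attained by one coefficient,
    so a single digit with multiplier 1 suffices; over the two-element field there are
    \<open>d i\<close> digits.\<close>
  let ?P1 = "SIGMA i:{1..t}. IA i \<times> {..<(1::nat)}" and ?P0 = "SIGMA i:{1..t}. IA_adj i \<times> {..<d i}"
  have fin_P1: "finite ?P1" and fin_P0: "finite ?P0"
    using K1.finite_I K0.finite_I by auto
  have UNIV: "closed_scalars ?R"
    by (simp add: closed_scalars_def)
  have F2: "closed_scalars (F2 :: 'l cyc set)"
    by (rule closed_scalars_F2)
  have scalar_span: "\<exists>a. (\<forall>q<1::nat. a q \<in> ?R) \<and> y = (\<Sum>q<1. ev (\<beta> i) (a q * 1))"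
    if "i \<in> {1..t}" "y \<in> Fq (\<beta> i)" for i y
    using that by (auto simp: Fq_eq_range_ev intro: exI[of _ "\<lambda>_. _"])

  let ?GA = "mat_GA nA t c \<beta> IA g1"
  have "row_span ?R ?GA = lin_combs ?R nA ?P1 (\<lambda>(i, j, q) k. 1 * ev_inv (c i) (\<beta> i) (g1 i j $ k))"
    unfolding mat_GA_def
  proof (rule row_span_mat_of_rows[OF UNIV fin_P1])
    have "map_vec (ev_inv (c i) (\<beta> i)) (g1 i j) = vec nA (\<lambda>k. 1 * ev_inv (c i) (\<beta> i) (g1 i j $ k))"
      if "i \<in> {1..t}" "j \<in> IA i" for i j
      using K1.g_in_ker[OF that] by (intro eq_vecI) (auto simp: K1.ker_component_iff[OF that(1)])
    then show "set [map_vec (ev_inv (c i) (\<beta> i)) (g1 i j). i \<leftarrow> [1..<t+1], j \<leftarrow> sorted_list_of_set (IA i)]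
        = (\<lambda>p. vec nA ((\<lambda>(i, j, q) k. 1 * ev_inv (c i) (\<beta> i) (g1 i j $ k)) p)) ` ?P1"
      using K1.finite_I by (force simp: image_iff)
  qed
  then have GA: "row_span ?R ?GA = mat_kernel A"
    using K1.lin_combs_systematic_generators[where S = ?R and u = "\<lambda>_ _. 1" and d = "\<lambda>_. 1"] scalar_span
    by simp

  let ?EA_adj = "mat_EA_adj nA t c IA"
  \<comment> \<open>Conjugation is moved outside the rows, so that what remains inside is the family
    of lifted unit vectors for the instance with \<open>A\<close>.\<close>
  have "row_span ?R ?EA_adj
      = lin_combs ?R nA ?P1 (\<lambda>p k. cyc_conj (case p of (i, j, q) \<Rightarrow> 1 * (if j = k then c i else 0)))"
    unfolding mat_EA_adj_def
  proof (rule row_span_mat_of_rows[OF UNIV fin_P1])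
    have "cyc_conj (c i) \<cdot>\<^sub>v unit_vec nA j = vec nA (\<lambda>k. cyc_conj (1 * (if j = k then c i else 0)))" for i j
      by (intro eq_vecI) (auto simp: unit_vec_def cyc_conj_0)
    then show "set [cyc_conj (c i) \<cdot>\<^sub>v unit_vec nA j. i \<leftarrow> [1..<t+1], j \<leftarrow> sorted_list_of_set (IA i)]
        = (\<lambda>p. vec nA (\<lambda>k. cyc_conj (case p of (i, j, q) \<Rightarrow> 1 * (if j = k then c i else 0)))) ` ?P1"
      using K1.finite_I by (force simp: image_iff)
  qed
  then have EA_adj_iff: "v \<in> row_span ?R ?EA_adj \<longleftrightarrow> map_vec cyc_conj v \<in> lin_combs ?R nA ?P1
      (\<lambda>p k. case p of (i, j, q) \<Rightarrow> 1 * (if j = k then c i else 0))" for v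
    by (simp only: lin_combs_cyc_conj_iff[OF UNIV_I])
  have curry_1: "(\<lambda>p k. case p of (i, j, q) \<Rightarrow> 1 * (if j = k then c i else 0))
      = (\<lambda>(i, j, q) k. 1 * (if j = k then c i else 0))"
    by (auto simp: fun_eq_iff)
  have "lin_combs ?R nA ?P1 (\<lambda>(i, j, q) k. 1 * (if j = k then c i else 0)) = K1.coord_space"
    by (rule K1.lin_combs_unit_vectors[where u = "\<lambda>_ _. 1" and d = "\<lambda>_. 1"]) (rule scalar_span)
  then have EA_adj_iff: "v \<in> row_span ?R ?EA_adj \<longleftrightarrow> map_vec cyc_conj v \<in> K1.coord_space" for v
    unfolding EA_adj_iff curry_1 by (rule arg_cong)
  have EA_adj: "row_span_iso_coker ?R ?EA_adj (adjoint_mat A)"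
  proof (rule row_span_iso_cokerI[OF UNIV])
    have dim: "dim_row (adjoint_mat A) = nA"
      using assms(3) by (simp add: adjoint_mat_def)
    show "dim_col ?EA_adj = dim_row (adjoint_mat A)"
      by (simp add: dim mat_EA_adj_def)
    show "v = 0\<^sub>v (dim_row (adjoint_mat A))"
      if "v \<in> row_span ?R ?EA_adj" "v \<in> mat_image (adjoint_mat A)" for v
    proof -
      have "map_vec cyc_conj v = 0\<^sub>v nA"
        using that EA_adj_iff K1.coord_space_inter_image mat_image_adjoint_iff[OF assms(3)] by blast
      then show ?thesis
        unfolding dim by (metis map_vec_cyc_conj_conj map_vec_cyc_conj_0)
    qed
    show "\<exists>w\<in>row_span ?R ?EA_adj. v - w \<in> mat_image (adjoint_mat A)"
      if v: "v \<in> carrier_vec (dim_row (adjoint_mat A))" for v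
    proof -
      have "map_vec cyc_conj v \<in> carrier_vec nA"
        using v dim by simp
      \<comment> \<open>The conjugated vector is split along the complement of the image of the
        transpose, and the pieces are conjugated back.\<close>
      then obtain w where w: "w \<in> K1.coord_space" "map_vec cyc_conj v - w \<in> mat_image (transpose_mat A)"
        using K1.coord_space_plus_image by blast
      have "w \<in> carrier_vec nA"
        using w by (simp add: K1.coord_space_def)
      then have "map_vec cyc_conj (v - map_vec cyc_conj w) = map_vec cyc_conj v - w"
        using v dim by (intro eq_vecI) (auto simp: cyc_conj_diff cyc_conj_conj)
      then have "v - map_vec cyc_conj w \<in> mat_image (adjoint_mat A)"
        using w(2) by (simp add: mat_image_adjoint_iff[OF assms(3)])
      moreover have "map_vec cyc_conj w \<in> row_span ?R ?EA_adj"
        using w(1) by (simp add: EA_adj_iff map_vec_cyc_conj_conj)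
      ultimately show ?thesis
        by blast
    qed
  qed

  let ?GA_adj = "mat_GA_adj mA t c \<beta> d IA_adj g0 m"
  \<comment> \<open>Pulling conjugation out of a row turns its factor \<open>cyc_x ^ m i q\<close>
    into this multiplier, whose values at \<beta> i are the given basis elements.\<close>
  let ?x = "\<lambda>i q. cyc_conj (cyc_x :: 'l cyc) ^ m i q"
  have x_span: "\<exists>a. (\<forall>q<d i. a q \<in> F2) \<and> y = (\<Sum>q<d i. ev (\<beta> i) (a q * ?x i q))"
    if "i \<in> {1..t}" "y \<in> Fq (\<beta> i)" for i y
    using F2_basis_family_span[OF that(1) assms(18)[OF that(1)] that(2)] that(1)
    by (simp add: ev_mult ev_conj_x_power)
  have x_indep: "\<forall>q<d i. a q = a' q"
    if "i \<in> {1..t}" "\<forall>q<d i. a q \<in> F2 \<and> a' q \<in> F2"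
      "(\<Sum>q<d i. ev (\<beta> i) (a q * ?x i q)) = (\<Sum>q<d i. ev (\<beta> i) (a' q * ?x i q))" for i a a'
  proof (rule F2_basis_family_indep[OF that(1) assms(18)[OF that(1)] that(2)])
    show "(\<Sum>q<d i. ev (\<beta> i) (a q) * \<beta> i powi - int (m i q))
        = (\<Sum>q<d i. ev (\<beta> i) (a' q) * \<beta> i powi - int (m i q))"
      using that(1,3) by (simp add: ev_mult ev_conj_x_power)
  qed
  have "row_span F2 ?GA_adj = lin_combs F2 mA ?P0
      (\<lambda>p k. cyc_conj (case p of (i, j, q) \<Rightarrow> ?x i q * ev_inv (c i) (\<beta> i) (g0 i j $ k)))"
    unfolding mat_GA_adj_def
  proof (rule row_span_mat_of_rows[OF F2 fin_P0])
    have "cyc_x ^ m i q \<cdot>\<^sub>v map_vec cyc_conj (map_vec (ev_inv (c i) (\<beta> i)) (g0 i j))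
        = vec mA (\<lambda>k. cyc_conj (?x i q * ev_inv (c i) (\<beta> i) (g0 i j $ k)))"
      if "i \<in> {1..t}" "j \<in> IA_adj i" for i j q
      using K0.g_in_ker[OF that]
      by (intro eq_vecI) (auto simp: K0.ker_component_iff[OF that(1)] cyc_conj_mult cyc_conj_power cyc_conj_conj)
    then show "set [cyc_x ^ m i q \<cdot>\<^sub>v map_vec cyc_conj (map_vec (ev_inv (c i) (\<beta> i)) (g0 i j)).
          i \<leftarrow> [1..<t+1], j \<leftarrow> sorted_list_of_set (IA_adj i), q \<leftarrow> [0..<d i]]
        = (\<lambda>p. vec mA (\<lambda>k. cyc_conj (case p of (i, j, q) \<Rightarrow> ?x i q * ev_inv (c i) (\<beta> i) (g0 i j $ k)))) ` ?P0"
      using K0.finite_I by (intro set_component_list) simp_all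
  qed
  then have GA_adj_iff: "v \<in> row_span F2 ?GA_adj \<longleftrightarrow> map_vec cyc_conj v \<in> lin_combs F2 mA ?P0
      (\<lambda>p k. case p of (i, j, q) \<Rightarrow> ?x i q * ev_inv (c i) (\<beta> i) (g0 i j $ k))" for v
    by (simp only: lin_combs_cyc_conj_iff[OF cyc_conj_F2])
  have curry_x: "(\<lambda>p k. case p of (i, j, q) \<Rightarrow> ?x i q * ev_inv (c i) (\<beta> i) (g0 i j $ k))
      = (\<lambda>(i, j, q) k. ?x i q * ev_inv (c i) (\<beta> i) (g0 i j $ k))"
    by (auto simp: fun_eq_iff)
  have ker_eq: "lin_combs F2 mA ?P0 (\<lambda>(i, j, q) k. ?x i q * ev_inv (c i) (\<beta> i) (g0 i j $ k))
      = mat_kernel (transpose_mat A)"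
    by (rule K0.lin_combs_systematic_generators[where u = ?x]) (rule x_span)
  then have GA_adj_iff': "v \<in> row_span F2 ?GA_adj \<longleftrightarrow> map_vec cyc_conj v \<in> mat_kernel (transpose_mat A)" for v
    unfolding GA_adj_iff curry_x by (rule arg_cong)
  then have GA_adj: "row_span F2 ?GA_adj = mat_kernel (adjoint_mat A)"
    unfolding set_eq_iff mat_kernel_adjoint_iff[OF assms(3)] by (rule allI)
  \<comment> \<open>The count is available for the unconjugated combinations; conjugation, a
    bijection, carries it to the row span.\<close>
  have "bij_betw (map_vec cyc_conj) (row_span F2 ?GA_adj) (mat_kernel (transpose_mat A))"
    by (rule bij_betw_byWitness[where f' = "map_vec cyc_conj"])
      (simp_all add: GA_adj_iff' map_vec_cyc_conj_conj image_subset_iff)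
  then have "card (row_span F2 ?GA_adj) = card (mat_kernel (transpose_mat A))"
    by (rule bij_betw_same_card)
  also have "\<dots> = card (F2 :: 'l cyc set) ^ card ?P0"
    unfolding ker_eq[symmetric]
    by (rule K0.card_lin_combs_systematic_generators[where u = ?x]) (rule x_indep)
  finally have card_GA_adj: "card (row_span F2 ?GA_adj) = 2 ^ dim_row ?GA_adj"
    by (simp only: card_F2 dim_row_mat_GA_adj[OF K0.finite_I])
  have GA_adj_fewest: "fewest_rows (\<lambda>M. generates_ker F2 M (adjoint_mat A)) ?GA_adj"
  proof (rule fewest_rows_kerI)
    show "dim_col ?GA_adj = dim_col (adjoint_mat A)"
      using assms(3) by (simp add: mat_GA_adj_def adjoint_mat_def)
  qed (fact GA_adj card_GA_adj)+

  let ?EA = "mat_EA mA t c d IA_adj m h"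
  let ?h = "\<lambda>i q. h i (m i q)"
  have h_span: "\<exists>a. (\<forall>q<d i. a q \<in> F2) \<and> y = (\<Sum>q<d i. ev (\<beta> i) (a q * ?h i q))"
    if "i \<in> {1..t}" "y \<in> Fq (\<beta> i)" for i y
    \<comment> \<open>The positions at which coefficients are read are the exponents
      \<open>m i\<close> themselves.\<close>
    using assms(19) that by (intro dual_basis_span[where r = "m i", OF that(1) assms(18)[OF that(1)]]) auto
  have h_indep: "\<forall>q<d i. a q = a' q"
    if "i \<in> {1..t}" "\<forall>q<d i. a q \<in> F2 \<and> a' q \<in> F2"
      "(\<Sum>q<d i. ev (\<beta> i) (a q * ?h i q)) = (\<Sum>q<d i. ev (\<beta> i) (a' q * ?h i q))" for i a a'
    using assms(19) that by (intro dual_basis_indep[where r = "m i", OF that(1) assms(18)[OF that(1)]]) auto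
  have "row_span F2 ?EA = lin_combs F2 mA ?P0 (\<lambda>(i, j, q) k. ?h i q * (if j = k then c i else 0))"
    unfolding mat_EA_def
  proof (rule row_span_mat_of_rows[OF F2 fin_P0])
    have "(?h i q * c i) \<cdot>\<^sub>v unit_vec mA j = vec mA (\<lambda>k. ?h i q * (if j = k then c i else 0))" for i j q
      by (intro eq_vecI) (auto simp: unit_vec_def)
    then show "set [(?h i q * c i) \<cdot>\<^sub>v unit_vec mA j.
          i \<leftarrow> [1..<t+1], j \<leftarrow> sorted_list_of_set (IA_adj i), q \<leftarrow> [0..<d i]]
        = (\<lambda>p. vec mA ((\<lambda>(i, j, q) k. ?h i q * (if j = k then c i else 0)) p)) ` ?P0"
      using K0.finite_I by (intro set_component_list) simp_all
  qed
  moreover have "card (lin_combs F2 mA ?P0 (\<lambda>(i, j, q) k. ?h i q * (if j = k then c i else 0)))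
      = card (F2 :: 'l cyc set) ^ card ?P0"
    by (rule K0.card_lin_combs_unit_vectors[where u = ?h]) (rule h_indep)
  moreover have "lin_combs F2 mA ?P0 (\<lambda>(i, j, q) k. ?h i q * (if j = k then c i else 0)) = K0.coord_space"
    by (rule K0.lin_combs_unit_vectors[where u = ?h]) (rule h_span)
  ultimately have EA_eq: "row_span F2 ?EA = K0.coord_space"
    and card_EA: "card (row_span F2 ?EA) = 2 ^ dim_row ?EA"
    by (simp_all only: card_F2 dim_row_mat_EA[OF K0.finite_I])
  have dim_EA: "dim_col ?EA = dim_row A"
    using assms(3) by (simp add: mat_EA_def)
  have EA: "row_span_iso_coker F2 ?EA A"
    using K0.coord_space_inter_image K0.coord_space_plus_image assms(3)
    by (intro row_span_iso_cokerI[OF F2 dim_EA]) (auto simp: EA_eq)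
  show ?thesis
    using GA EA GA_adj EA_adj GA_adj_fewest fewest_rows_cokerI[OF dim_EA EA card_EA] by blast
qed

end
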